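(* As $p\to0$ (with $p\in(0,1]$) and $np\to+\infty$, the random variable $X_{n,p}=I(n,p)/(n^2p)$ converges in distribution to a random variable $X$ whose distribution is characterized as the unique solution with finite mean of the distributional equation $$X\overset{\text{law}}{=}U^2X+(1-U)^2\widetilde X+\frac{U^2+(1-U)^2}{2},$$ in which $U$ is uniformly distributed on $[0,1]$, $\widetilde X$ denotes a copy of $X$ (i.e. has the same distribution as $X$), and $X,\widetilde X,U$ on the right-hand side are independent. Furthermore, $\mathbb E[X]=1$ and $\mathrm{Var}(X)=\frac1{12}$.
   Context: Quicksort with errors: the input is a list of $n$ distinct numbers presented in uniformly random order (each of the $n!$ orders equiprobable). An empty list is returned as is. For a nonempty list, its first element is the pivot, and every other element is compared with the pivot; each comparison gives the wrong answer with probability $p$ (and the right answer with probability $1-p$), independently of all other comparisons, of positions and of values. The elements declared smaller than the pivot form the left sublist, those declared larger form the right sublist (each kept in its original relative order). The same procedure is applied recursively, with independent new errors, to the two sublists, and the output is the concatenation of the output of the left sublist, the pivot, and the output of the right sublist. For a sequence $y=(y_1,\dots,y_n)$ the number of inversions is $I(y)=\#\{(i,j):1\le i<j\le n,\ y_i>y_j\}$. $I(n,p)$ denotes the random number of inversions of the output of Quicksort with errors on an input of length $n$ with error probability $p$. *)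

theory Defs
  imports "HOL-Probability.Probability" "HOL-Combinatorics.Multiset_Permutations"
begin

text \<open>
  A comparison errs with probability \<open>p\<close>, so that \<open>y\<close> is declared smaller than
  the pivot iff exactly one of \<open>y < pivot\<close> and \<open>err\<close> holds.
\<close>

fun noisy_partition :: "real \<Rightarrow> 'a::linorder \<Rightarrow> 'a list \<Rightarrow> ('a list \<times> 'a list) pmf" where
  "noisy_partition p pivot [] = return_pmf ([], [])"
| "noisy_partition p pivot (y # ys) =
     do {
       err \<leftarrow> bernoulli_pmf p;
       (ls, rs) \<leftarrow> noisy_partition p pivot ys;
       return_pmf (if (y < pivot) \<noteq> err then (y # ls, rs) else (ls, y # rs))
     }"

lemma noisy_partition_length:
  "(ls, rs) \<in> set_pmf (noisy_partition p pivot ys) \<Longrightarrow> length ls + length rs = length ys"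
  by (induction ys arbitrary: ls rs) (fastforce split: if_splits)+

function noisy_quicksort :: "real \<Rightarrow> 'a::linorder list \<Rightarrow> 'a list pmf" where
  "noisy_quicksort p [] = return_pmf []"
| "noisy_quicksort p (x # xs) =
     do {
       (ls, rs) \<leftarrow> noisy_partition p x xs;
       left \<leftarrow> noisy_quicksort p ls;
       right \<leftarrow> noisy_quicksort p rs;
       return_pmf (left @ x # right)
     }"
  by pat_completeness auto
termination
  by (relation "Wellfounded.measure (\<lambda>(p, xs). length xs)") (auto dest!: noisy_partition_length)

definition inversions :: "'a::linorder list \<Rightarrow> nat" where
  "inversions ys = card {(i, j). i < j \<and> j < length ys \<and> ys ! i > ys ! j}"

text \<open>
  The law of \<open>I(n, p)\<close>, for an input consisting of the \<open>n\<close> elements of the finite set \<open>A\<close>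
  in uniformly random order.
\<close>

definition inversions_pmf :: "'a::linorder set \<Rightarrow> real \<Rightarrow> nat pmf" where
  "inversions_pmf A p =
     do {
       xs \<leftarrow> pmf_of_set (permutations_of_set A);
       ys \<leftarrow> noisy_quicksort p xs;
       return_pmf (inversions ys)
     }"

definition normalized_inversions_law :: "'a::linorder set \<Rightarrow> real \<Rightarrow> real measure" where
  "normalized_inversions_law A p =
     distr (measure_pmf (inversions_pmf A p)) borel
       (\<lambda>i. real i / ((real (card A))\<^sup>2 * p))"

text \<open>
  The law of the right-hand side of the distributional equation: independence of
  \<open>X\<close>, its copy and \<open>U\<close> means that their joint law is the product measure.
\<close>

definition rhs_law :: "real measure \<Rightarrow> real measure" where
  "rhs_law \<mu> =
     distr (\<mu> \<Otimes>\<^sub>M \<mu> \<Otimes>\<^sub>M uniform_measure lborel {0..1::real}) borel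
       (\<lambda>(x, x', u). u\<^sup>2 * x + (1 - u)\<^sup>2 * x' + (u\<^sup>2 + (1 - u)\<^sup>2) / 2)"

definition finite_mean_solution :: "real measure \<Rightarrow> bool" where
  "finite_mean_solution \<mu> \<longleftrightarrow>
     real_distribution \<mu> \<and> integrable \<mu> (\<lambda>x. x) \<and> \<mu> = rhs_law \<mu>"

end

theory Submission
  imports Defs
begin

text \<open>
  Characteristic functions carry the whole proof. Conditioning the distributional equation on
  \<open>U = u\<close> turns it into a fixed point equation
  \<open>\<phi>(t) = \<integral> \<phi>(u\<^sup>2 t) \<phi>((1 - u)\<^sup>2 t) exp(i t (u\<^sup>2 + (1 - u)\<^sup>2) / 2) du\<close> over the unit interval
  (\<open>char_rhs_law\<close>). With respect to the distance \<open>sup |\<phi>(t) - \<psi>(t)| / |t|\<close>, which is finite for laws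
  with finite mean, the right-hand side contracts by \<open>E[U\<^sup>2 + (1 - U)\<^sup>2] = 2/3\<close>
  (\<open>char_rhs_law_contraction\<close>). Uniqueness follows at once. For existence, the map is iterated from
  the point mass at 1: all iterates have mean 1 and second moment at most \<open>13/12\<close>, so a subsequence
  converges weakly, and the contraction forces its limit to be a fixed point. Fatou's lemma bounds
  the second moment of the limit, and then mean and variance can be read off the equation.

  For the convergence, let \<open>G\<^sub>A(\<theta>)\<close> be the characteristic function of the number of inversions on
  the input set \<open>A\<close>. The errors do not depend on the order of the input, so given the pivot and the
  set of misjudged elements, the two sublists are independent and in uniformly random order. Hence
  \<open>G\<^sub>A\<close> is an average, over the pivot and the errors, of
  \<open>G\<^sub>L(\<theta>) G\<^sub>R(\<theta>) exp(i \<theta> C)\<close>, where \<open>C\<close> counts the inversions across the split (\<open>inv_char_rec\<close>).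
  A pivot of rank \<open>s\<close> corresponds to \<open>u = s/n\<close>; the sublists have length \<open>s\<close> and \<open>n - 1 - s\<close> up to
  the number of errors, and \<open>C\<close> is, up to pairs of errors, a weighted sum of independent error
  indicators with mean about \<open>p (s\<^sup>2 + (n - s)\<^sup>2) / 2\<close> and standard deviation at most
  \<open>sqrt (p n\<^sup>3)\<close>. Comparing with a Riemann sum of the fixed point equation gives, by induction on the
  size \<open>n\<close> of \<open>A\<close> and for \<open>p \<le> 1/100\<close>, the explicit bound
  \<open>|G\<^sub>A(t / (n\<^sup>2 p)) - \<phi>(t)| \<le> c |t| (1 / sqrt (n p) + p)\<close> (\<open>inv_char_approx\<close>). The induction closes
  because both error terms contract: the squared relative lengths of the sublists sum to \<open>2/3\<close> on
  average, and their powers of exponent \<open>3/2\<close> also have sum below 1 on average. The bound tends to 0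
  in the regime of the theorem, where eventually \<open>p \<le> 1/100\<close>, and Levy's continuity theorem finishes the proof.
\<close>


section \<open>The characteristic function of the right-hand side\<close>

abbreviation unif :: "real measure" where "unif \<equiv> uniform_measure lborel {0..1}"

definition toll :: "real \<Rightarrow> real" where "toll u = (u\<^sup>2 + (1 - u)\<^sup>2) / 2"

text \<open>The characteristic function, at \<open>t\<close>, of the right-hand side of the equation conditioned on \<open>U = u\<close>,
  when \<open>\<phi>\<close> is the characteristic function of \<open>X\<close>.\<close>
definition split_integrand :: "(real \<Rightarrow> complex) \<Rightarrow> real \<Rightarrow> real \<Rightarrow> complex" where
  "split_integrand \<phi> t u = \<phi> (u\<^sup>2 * t) * \<phi> ((1 - u)\<^sup>2 * t) * iexp (t * toll u)"

lemma prob_space_unif: "prob_space unif"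
  by (rule prob_space_uniform_measure) auto

lemma unif_integral:
  fixes f :: "real \<Rightarrow> 'a::euclidean_space"
  assumes "continuous_on UNIV f"
  shows "integrable unif f" "integral\<^sup>L unif f = integral {0..1} f"
proof -
  have [measurable]: "f \<in> borel_measurable borel"
    using assms by (rule borel_measurable_continuous_onI)
  have d: "unif = density lborel (\<lambda>x. indicator {0..1::real} x)"
    unfolding uniform_measure_def by (rule density_cong) (auto simp: divide_ennreal_def)
  have d': "density lborel (\<lambda>x. indicator {0..1::real} x) 
      = density lborel (\<lambda>x. ennreal (indicator {0..1::real} x))"
    by (simp add: ennreal_indicator)
  have si: "set_integrable lborel {0..1} f"
    by (rule borel_integrable_atLeastAtMost') (use assms continuous_on_subset in blast)
  show "integrable unif f" unfolding d d'
    by (subst integrable_density) (use si in \<open>auto simp: set_integrable_def\<close>)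
  show "integral\<^sup>L unif f = integral {0..1} f"
    unfolding d d' by (subst integral_density)
      (use set_borel_integral_eq_integral(2)[OF si] in \<open>auto simp: set_lebesgue_integral_def\<close>)
qed

lemma unif_integral_FTC:
  fixes f F :: "real \<Rightarrow> real"
  assumes "continuous_on UNIV f" "\<And>x. (F has_real_derivative f x) (at x)" "F 1 - F 0 = c"
  shows "has_bochner_integral unif f c"
proof -
  have "(f has_integral (F 1 - F 0)) {0..1}"
    by (rule fundamental_theorem_of_calculus)
      (auto intro!: DERIV_subset[OF assms(2)] simp flip: has_real_derivative_iff_has_vector_derivative)
  thus ?thesis
    using unif_integral[OF assms(1)] assms(3) by (auto simp: integral_unique has_bochner_integral_iff)
qed

lemma unif_square:
  "has_bochner_integral unif (\<lambda>u. u\<^sup>2) (1/3)" "has_bochner_integral unif (\<lambda>u. (1-u)\<^sup>2) (1/3)"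
  by (rule unif_integral_FTC[where F = "\<lambda>u. u^3/3"] unif_integral_FTC[where F = "\<lambda>u. -((1-u)^3)/3"];
      auto intro!: derivative_eq_intros continuous_intros simp: power2_eq_square)+

lemma integrable_pair_mult:
  fixes f :: "'a \<Rightarrow> real" and g :: "'b \<Rightarrow> real"
  assumes "prob_space M" "prob_space N" "integrable M f" "integrable N g"
  shows "integrable (M \<Otimes>\<^sub>M N) (\<lambda>(x, y). f x * g y)"
    and "(LINT z|(M \<Otimes>\<^sub>M N). (case z of (x, y) \<Rightarrow> f x * g y)) = integral\<^sup>L M f * integral\<^sup>L N g"
proof -
  interpret M: prob_space M by fact
  interpret N: prob_space N by fact
  interpret pair_prob_space M N ..
  note [measurable] = borel_measurable_integrable[OF assms(3)] borel_measurable_integrable[OF assms(4)]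
  show *: "integrable (M \<Otimes>\<^sub>M N) (\<lambda>(x, y). f x * g y)"
    by (rule Fubini_integrable) (use assms in \<open>auto simp: abs_mult split_beta'\<close>)
  show "(LINT z|(M \<Otimes>\<^sub>M N). (case z of (x, y) \<Rightarrow> f x * g y)) = integral\<^sup>L M f * integral\<^sup>L N g"
    using integral_fst[OF *] by simp
qed

lemma has_bochner_integral_triple_product:
  fixes f g h :: "real \<Rightarrow> real"
  assumes "prob_space \<mu>" "has_bochner_integral \<mu> f a" "has_bochner_integral \<mu> g b" "has_bochner_integral unif h c"
  shows "has_bochner_integral (\<mu> \<Otimes>\<^sub>M \<mu> \<Otimes>\<^sub>M unif) (\<lambda>(x, x', u). f x * g x' * h u) (a * b * c)"
proof -
  interpret M: prob_space \<mu> by fact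
  interpret U: prob_space unif by (rule prob_space_unif)
  interpret MU: pair_prob_space \<mu> unif ..
  note i = assms(2-)[unfolded has_bochner_integral_iff]
  note a = integrable_pair_mult[OF assms(1) prob_space_unif i(2)[THEN conjunct1] i(3)[THEN conjunct1]]
  note b = integrable_pair_mult[OF assms(1) MU.prob_space_axioms i(1)[THEN conjunct1] a(1)]
  have "(\<lambda>(x, x', u). f x * g x' * h u) = (\<lambda>(x, y). f x * (case y of (x', u) \<Rightarrow> g x' * h u))"
    by (auto simp: fun_eq_iff)
  with a b i show ?thesis by (simp add: has_bochner_integral_iff mult.assoc)
qed

lemma rhs_map_measurable:
  assumes "sets \<mu> = sets borel"
  shows "(\<lambda>(x, x', u). u\<^sup>2 * x + (1 - u)\<^sup>2 * x' + (u\<^sup>2 + (1 - u)\<^sup>2) / 2)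
    \<in> borel_measurable (\<mu> \<Otimes>\<^sub>M \<mu> \<Otimes>\<^sub>M unif)"
proof -
  note [measurable_cong] = assms
  show ?thesis by measurable
qed

lemma real_distribution_rhs_law:
  assumes "real_distribution \<mu>"
  shows "real_distribution (rhs_law \<mu>)"
proof -
  interpret M: real_distribution \<mu> by fact
  interpret U: prob_space unif by (rule prob_space_unif)
  interpret MU: pair_prob_space \<mu> unif ..
  interpret P: pair_prob_space \<mu> "\<mu> \<Otimes>\<^sub>M unif" ..
  show ?thesis unfolding rhs_law_def
    by (intro P.real_distribution_distr rhs_map_measurable M.events_eq_borel)
qed

text \<open>For fixed \<open>u\<close> the exponential factors over the two independent copies of \<open>X\<close>, so Fubini's theorem
  is applied twice in order to integrate over \<open>U\<close> last.\<close>
lemma char_rhs_law: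
  assumes "real_distribution \<mu>"
  shows "char (rhs_law \<mu>) t = (LINT u|unif. split_integrand (char \<mu>) t u)"
proof -
  interpret M: real_distribution \<mu> by fact
  interpret U: prob_space unif by (rule prob_space_unif)
  interpret MU: pair_prob_space \<mu> unif ..
  interpret P: pair_prob_space \<mu> "\<mu> \<Otimes>\<^sub>M unif" ..
  let ?E = "\<lambda>x x' u. iexp (t * (u\<^sup>2 * x + (1 - u)\<^sup>2 * x' + toll u))"
  have [measurable]: "toll \<in> borel_measurable borel" unfolding toll_def[abs_def] by measurable
  have i3: "integrable (\<mu> \<Otimes>\<^sub>M \<mu> \<Otimes>\<^sub>M unif) (\<lambda>(x, z). case z of (x', u) \<Rightarrow> ?E x x' u)"
    unfolding split_beta' by (rule P.integrable_iexp) measurable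
  have i2: "integrable (\<mu> \<Otimes>\<^sub>M unif) (\<lambda>(x', u). char \<mu> (u\<^sup>2 * t) * iexp (t * ((1 - u)\<^sup>2 * x' + toll u)))"
    by (rule MU.P.integrable_const_bound[where B = 1])
       (auto simp: split_beta' norm_mult intro!: AE_I2 M.cmod_char_le_1)
  have "char (rhs_law \<mu>) t = (LINT z|(\<mu> \<Otimes>\<^sub>M \<mu> \<Otimes>\<^sub>M unif). (case z of (x, (x', u)) \<Rightarrow> ?E x x' u))"
    unfolding char_def rhs_law_def
    by (subst integral_distr[OF rhs_map_measurable])
       (auto simp: toll_def split_beta' intro!: Bochner_Integration.integral_cong)
  also have "\<dots> = (LINT z|(\<mu> \<Otimes>\<^sub>M unif). LINT x|\<mu>. (case z of (x', u) \<Rightarrow> ?E x x' u))"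
    by (rule P.integral_snd[OF i3, symmetric])
  also have "\<dots> = (LINT z|(\<mu> \<Otimes>\<^sub>M unif). (case z of (x', u) \<Rightarrow> 
      char \<mu> (u\<^sup>2 * t) * iexp (t * ((1 - u)\<^sup>2 * x' + toll u))))"
  proof (intro Bochner_Integration.integral_cong refl, clarify)
    fix x' u
    have "(LINT x|\<mu>. ?E x x' u) = (LINT x|\<mu>. iexp (u\<^sup>2 * t * x) * iexp (t * ((1 - u)\<^sup>2 * x' + toll u)))"
      by (intro Bochner_Integration.integral_cong refl) (simp add: exp_add[symmetric] algebra_simps)
    thus "(LINT x|\<mu>. ?E x x' u) = char \<mu> (u\<^sup>2 * t) * iexp (t * ((1 - u)\<^sup>2 * x' + toll u))"
      by (simp add: char_def)
  qed
  also have "\<dots> = (LINT u|unif. LINT x'|\<mu>. char \<mu> (u\<^sup>2 * t) * iexp (t * ((1 - u)\<^sup>2 * x' + toll u)))"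
    by (rule MU.integral_snd[OF i2, symmetric])
  also have "\<dots> = (LINT u|unif. split_integrand (char \<mu>) t u)"
  proof (intro Bochner_Integration.integral_cong refl)
    fix u
    have "(LINT x'|\<mu>. char \<mu> (u\<^sup>2 * t) * iexp (t * ((1 - u)\<^sup>2 * x' + toll u))) =
      (LINT x'|\<mu>. char \<mu> (u\<^sup>2 * t) * iexp (t * toll u) * iexp ((1 - u)\<^sup>2 * t * x'))"
      by (intro Bochner_Integration.integral_cong refl) (simp add: exp_add[symmetric] algebra_simps)
    thus "(LINT x'|\<mu>. char \<mu> (u\<^sup>2 * t) * iexp (t * ((1 - u)\<^sup>2 * x' + toll u))) = split_integrand (char \<mu>) t u"
      by (simp add: char_def split_integrand_def mult_ac)
  qed
  finally show ?thesis .
qed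

text \<open>All the coefficients are moments of the uniform law: the right-hand side and its square are sums of
  products of a function of \<open>X\<close>, a function of its copy and a polynomial in \<open>U\<close>.\<close>
lemma rhs_law_moments:
  assumes "real_distribution \<mu>" "integrable \<mu> (\<lambda>x. x\<^sup>2)"
  defines "m \<equiv> integral\<^sup>L \<mu> (\<lambda>x. x)" and "s \<equiv> integral\<^sup>L \<mu> (\<lambda>x. x\<^sup>2)"
  shows "has_bochner_integral (rhs_law \<mu>) (\<lambda>x. x) (2/3 * m + 1/3)"
    and "has_bochner_integral (rhs_law \<mu>) (\<lambda>x. x\<^sup>2) (2/5 * s + m\<^sup>2 / 15 + 7/15 * m + 7/60)"
proof -
  interpret M: real_distribution \<mu> by fact
  let ?P = "\<mu> \<Otimes>\<^sub>M \<mu> \<Otimes>\<^sub>M unif"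
  have i1: "integrable \<mu> (\<lambda>x. x)"
    by (rule M.square_integrable_imp_integrable) (use assms in auto)
  note u1 = unif_square(1) and u2 = unif_square(2)
  have u3: "has_bochner_integral unif toll (1/3)"
    unfolding toll_def[abs_def] by (rule unif_integral_FTC[where F = "\<lambda>u. u^3/6 -(1-u)^3/6"]) 
       (auto intro!: derivative_eq_intros continuous_intros simp: power2_eq_square field_simps)
  have u4: "has_bochner_integral unif (\<lambda>u. u^4) (1/5)"
    by (rule unif_integral_FTC[where F = "\<lambda>u. u^5/5"]) 
       (auto intro!: derivative_eq_intros continuous_intros)
  have u5: "has_bochner_integral unif (\<lambda>u. (1-u)^4) (1/5)"
    by (rule unif_integral_FTC[where F = "\<lambda>u. -((1-u)^5)/5"]) 
       (auto intro!: derivative_eq_intros continuous_intros)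
  have u6: "has_bochner_integral unif (\<lambda>u. 2 * u\<^sup>2 * (1-u)\<^sup>2) (1/15)"
    by (rule unif_integral_FTC[where F = "\<lambda>u. 2 * (u^3/3 - u^4/2 + u^5/5)"]) 
       (auto intro!: derivative_eq_intros continuous_intros simp: power2_eq_square power3_eq_cube power4_eq_xxxx field_simps)
  have u7: "has_bochner_integral unif (\<lambda>u. 2 * u\<^sup>2 * toll u) (7/30)"
    unfolding toll_def by (rule unif_integral_FTC[where F = "\<lambda>u. 2*u^5/5 - u^4/2 + u^3/3"]) 
       (auto intro!: derivative_eq_intros continuous_intros simp: power2_eq_square power3_eq_cube power4_eq_xxxx field_simps)
  have u8: "has_bochner_integral unif (\<lambda>u. 2 * (1-u)\<^sup>2 * toll u) (7/30)"
    unfolding toll_def by (rule unif_integral_FTC[where F = "\<lambda>u. -(2*(1-u)^5/5 - (1-u)^4/2 + (1-u)^3/3)"]) 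
       (auto intro!: derivative_eq_intros continuous_intros simp: power2_eq_square power3_eq_cube power4_eq_xxxx field_simps)
  have u9: "has_bochner_integral unif (\<lambda>u. (toll u)\<^sup>2) (7/60)"
    unfolding toll_def by (rule unif_integral_FTC[where F = "\<lambda>u. u^5/5 - u^4/2 + 2*u^3/3 - u^2/2 + u/4"]) 
       (auto intro!: derivative_eq_intros continuous_intros simp: power2_eq_square power3_eq_cube power4_eq_xxxx field_simps)
  note T = has_bochner_integral_triple_product[OF M.prob_space_axioms]
  have m0: "has_bochner_integral \<mu> (\<lambda>_. 1) (1::real)"
    using M.prob_space by (simp add: has_bochner_integral_iff del: M.space_eq_univ)
  have m1: "has_bochner_integral \<mu> (\<lambda>x. x) m" using i1 by (simp add: has_bochner_integral_iff m_def)
  have m2: "has_bochner_integral \<mu> (\<lambda>x. x\<^sup>2) s" using assms by (simp add: has_bochner_integral_iff s_def)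
  have tr: "has_bochner_integral (rhs_law \<mu>) f c"
    if "has_bochner_integral ?P (\<lambda>(x,x',u). f (u\<^sup>2 * x + (1 - u)\<^sup>2 * x' + (u\<^sup>2 + (1 - u)\<^sup>2) / 2)) c"
       "f \<in> borel_measurable borel" for f :: "real \<Rightarrow> real" and c
    using that rhs_map_measurable[OF M.events_eq_borel] unfolding rhs_law_def
    by (auto simp: has_bochner_integral_iff integrable_distr_eq integral_distr split_beta')
  show "has_bochner_integral (rhs_law \<mu>) (\<lambda>x. x) (2/3 * m + 1/3)"
  proof (rule tr)
    show "has_bochner_integral ?P (\<lambda>(x,x',u). u\<^sup>2 * x + (1 - u)\<^sup>2 * x' + (u\<^sup>2 + (1 - u)\<^sup>2) / 2) (2/3 * m + 1/3)"
      using has_bochner_integral_add[OF has_bochner_integral_add[OF 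
          T[OF m1 m0 u1] T[OF m0 m1 u2]] T[OF m0 m0 u3]]
      by (simp add: split_beta' toll_def mult_ac add_ac)
  qed simp
  show "has_bochner_integral (rhs_law \<mu>) (\<lambda>x. x\<^sup>2) (2/5 * s + m\<^sup>2 / 15 + 7/15 * m + 7/60)"
  proof (rule tr)
    have "has_bochner_integral ?P (\<lambda>(x,x',u). (u\<^sup>2 * x + (1 - u)\<^sup>2 * x' + toll u)\<^sup>2) 
         (2/5 * s + m\<^sup>2 / 15 + 7/15 * m + 7/60)"
    proof (rule has_bochner_integral_cong[THEN iffD1, OF refl _ _ 
        has_bochner_integral_add[OF has_bochner_integral_add[OF has_bochner_integral_add[OF 
          T[OF m2 m0 u4] T[OF m0 m2 u5]] 
          has_bochner_integral_add[OF T[OF m1 m1 u6] T[OF m0 m0 u9]]]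
          has_bochner_integral_add[OF T[OF m1 m0 u7] T[OF m0 m1 u8]]]])
    qed (auto simp: algebra_simps power2_eq_square power4_eq_xxxx)
    thus "has_bochner_integral ?P (\<lambda>(x,x',u). (u\<^sup>2 * x + (1 - u)\<^sup>2 * x' + (u\<^sup>2 + (1 - u)\<^sup>2) / 2)\<^sup>2) 
       (2/5 * s + m\<^sup>2 / 15 + 7/15 * m + 7/60)"
      by (simp add: toll_def)
  qed simp
qed

section \<open>Contraction and uniqueness\<close>

lemma iexp_lipschitz: "cmod (iexp a - iexp b) \<le> \<bar>a - b\<bar>"
proof -
  have "iexp a - iexp b = iexp b * (iexp (a - b) - 1)"
    by (simp add: algebra_simps flip: exp_add)
  also have "cmod \<dots> \<le> \<bar>a - b\<bar>"
    using iexp_approx1[of "a - b" 0] by (simp add: norm_mult)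
  finally show ?thesis .
qed

lemma (in real_distribution) char_lipschitz:
  assumes "integrable M (\<lambda>x. x)"
  shows "cmod (char M s - char M t) \<le> \<bar>s - t\<bar> * integral\<^sup>L M (\<lambda>x. \<bar>x\<bar>)"
proof -
  have "char M s - char M t = (CLINT x|M. iexp (s * x) - iexp (t * x))"
    unfolding char_def by (rule Bochner_Integration.integral_diff[symmetric]) (auto intro!: integrable_iexp)
  also have "cmod \<dots> \<le> integral\<^sup>L M (\<lambda>x. \<bar>s - t\<bar> * \<bar>x\<bar>)"
  proof (rule Bochner_Integration.integral_norm_bound_integral)
    show "cmod (iexp (s * x) - iexp (t * x)) \<le> \<bar>s - t\<bar> * \<bar>x\<bar>" for x
      using iexp_lipschitz[of "s * x" "t * x"] by (simp add: abs_mult flip: left_diff_distrib)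
  qed (use assms in \<open>auto intro!: Bochner_Integration.integrable_diff integrable_iexp\<close>)
  finally show ?thesis by simp
qed

lemma char_diff_le_abs_means:
  assumes "real_distribution \<mu>" "integrable \<mu> (\<lambda>x. x)" "real_distribution \<nu>" "integrable \<nu> (\<lambda>x. x)"
  shows "cmod (char \<mu> t - char \<nu> t) \<le> (integral\<^sup>L \<mu> (\<lambda>x. \<bar>x\<bar>) + integral\<^sup>L \<nu> (\<lambda>x. \<bar>x\<bar>)) * \<bar>t\<bar>"
proof -
  interpret M: real_distribution \<mu> by fact
  interpret N: real_distribution \<nu> by fact
  have "cmod (char \<mu> t - char \<nu> t) = cmod ((char \<mu> t - char \<mu> 0) - (char \<nu> t - char \<nu> 0))"
    by (simp add: M.char_zero N.char_zero)
  also have "\<dots> \<le> cmod (char \<mu> t - char \<mu> 0) + cmod (char \<nu> t - char \<nu> 0)"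
    by (rule norm_triangle_ineq4)
  also have "\<dots> \<le> \<bar>t - 0\<bar> * integral\<^sup>L \<mu> (\<lambda>x. \<bar>x\<bar>) + \<bar>t - 0\<bar> * integral\<^sup>L \<nu> (\<lambda>x. \<bar>x\<bar>)"
    by (intro add_mono M.char_lipschitz N.char_lipschitz assms)
  finally show ?thesis by (simp add: algebra_simps)
qed

text \<open>Replacing one factor at a time costs only the change of that factor, as all the others lie in the
  unit ball. This is how every comparison with \<open>split_integrand\<close> below is done.\<close>
lemma norm_triple_product_diff:
  fixes a b c :: "'a::real_normed_algebra"
  assumes "norm b \<le> 1" "norm c \<le> 1" "norm a' \<le> 1" "norm b' \<le> 1"
  shows "norm (a * b * c - a' * b' * c') \<le> norm (a - a') + norm (b - b') + norm (c - c')"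
proof -
  have "a * b * c - a' * b' * c' = (a - a') * (b * c) + (a' * (b - b') * c + a' * b' * (c - c'))"
    by (simp add: algebra_simps)
  also have "norm \<dots> \<le> norm (a - a') * (norm b * norm c) +
      (norm a' * norm (b - b') * norm c + norm a' * norm b' * norm (c - c'))"
    by (intro norm_triangle_mono order_trans[OF norm_mult_ineq] mult_mono norm_mult_ineq mult_nonneg_nonneg) auto
  also have "\<dots> \<le> norm (a - a') * (1 * 1) + (1 * norm (b - b') * 1 + 1 * 1 * norm (c - c'))"
    using assms by (intro add_mono mult_mono mult_nonneg_nonneg) auto
  finally show ?thesis by simp
qed

lemma (in real_distribution) continuous_split_integrand:
  "continuous_on UNIV (split_integrand (char M) t)"
  unfolding split_integrand_def[abs_def] toll_def
  by (intro continuous_intros continuous_on_compose2[OF continuous_at_imp_continuous_on[of UNIV "char M"]])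
     (auto intro: isCont_char)

text \<open>The arguments \<open>u\<^sup>2 t\<close> and \<open>(1 - u)\<^sup>2 t\<close> scale the bound by \<open>u\<^sup>2\<close> and \<open>(1 - u)\<^sup>2\<close>, each of mean
  \<open>1/3\<close>; the exponential factors agree.\<close>
lemma char_rhs_law_contraction:
  assumes "real_distribution \<mu>" "real_distribution \<nu>"
    and "\<And>s. cmod (char \<mu> s - char \<nu> s) \<le> C * \<bar>s\<bar>"
  shows "cmod (char (rhs_law \<mu>) t - char (rhs_law \<nu>) t) \<le> 2/3 * C * \<bar>t\<bar>"
proof -
  interpret M: real_distribution \<mu> by fact
  interpret N: real_distribution \<nu> by fact
  note im = unif_integral(1)[OF M.continuous_split_integrand[of t]]
  note i_n = unif_integral(1)[OF N.continuous_split_integrand[of t]]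
  have u: "has_bochner_integral unif (\<lambda>u. C * \<bar>t\<bar> * u\<^sup>2 + C * \<bar>t\<bar> * (1 - u)\<^sup>2) (2/3 * C * \<bar>t\<bar>)"
    using has_bochner_integral_add[OF has_bochner_integral_mult_right[OF unif_square(1), of "C * \<bar>t\<bar>"]
      has_bochner_integral_mult_right[OF unif_square(2), of "C * \<bar>t\<bar>"]] by (simp add: mult_ac)
  have "char (rhs_law \<mu>) t - char (rhs_law \<nu>) t =
      (LINT u|unif. split_integrand (char \<mu>) t u - split_integrand (char \<nu>) t u)"
    using im i_n by (simp add: char_rhs_law assms)
  also have "cmod \<dots> \<le> (LINT u|unif. C * \<bar>t\<bar> * u\<^sup>2 + C * \<bar>t\<bar> * (1 - u)\<^sup>2)"
  proof (rule Bochner_Integration.integral_norm_bound_integral)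
    fix u
    have "cmod (split_integrand (char \<mu>) t u - split_integrand (char \<nu>) t u) \<le>
      cmod (char \<mu> (u\<^sup>2 * t) - char \<nu> (u\<^sup>2 * t)) + cmod (char \<mu> ((1 - u)\<^sup>2 * t) - char \<nu> ((1 - u)\<^sup>2 * t)) 
       + cmod (iexp (t * toll u) - iexp (t * toll u))"
      unfolding split_integrand_def
      by (rule norm_triple_product_diff) (auto intro: M.cmod_char_le_1 N.cmod_char_le_1)
    also have "\<dots> \<le> C * \<bar>t\<bar> * u\<^sup>2 + C * \<bar>t\<bar> * (1 - u)\<^sup>2"
      using assms(3)[of "u\<^sup>2 * t"] assms(3)[of "(1-u)\<^sup>2 * t"] by (simp add: abs_mult mult_ac)
    finally show "cmod (split_integrand (char \<mu>) t u - split_integrand (char \<nu>) t u) \<le> C * \<bar>t\<bar> * u\<^sup>2 + C * \<bar>t\<bar> * (1 - u)\<^sup>2" .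
  qed (use im i_n u in \<open>auto simp: has_bochner_integral_iff\<close>)
  also have "\<dots> = 2/3 * C * \<bar>t\<bar>" using u by (simp add: has_bochner_integral_iff)
  finally show ?thesis .
qed

lemma finite_mean_solution_unique:
  assumes "finite_mean_solution \<mu>" "finite_mean_solution \<nu>"
  shows "\<mu> = \<nu>"
proof -
  interpret M: real_distribution \<mu> using assms by (simp add: finite_mean_solution_def)
  interpret N: real_distribution \<nu> using assms by (simp add: finite_mean_solution_def)
  have rd: "real_distribution \<mu>" "real_distribution \<nu>" by unfold_locales
  have fp: "rhs_law \<mu> = \<mu>" "rhs_law \<nu> = \<nu>" and int: "integrable \<mu> (\<lambda>x. x)" "integrable \<nu> (\<lambda>x. x)"
    using assms by (simp_all add: finite_mean_solution_def)
  define C where "C = M.expectation (\<lambda>x. \<bar>x\<bar>) + N.expectation (\<lambda>x. \<bar>x\<bar>)"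
  have "cmod (char \<mu> t - char \<nu> t) \<le> (2/3)^k * C * \<bar>t\<bar>" for k t
  proof (induction k arbitrary: t)
    case 0
    show ?case using char_diff_le_abs_means[OF rd(1) int(1) rd(2) int(2)] by (simp add: C_def)
  next
    case (Suc k)
    from char_rhs_law_contraction[OF rd Suc] show ?case by (simp add: fp mult_ac)
  qed
  hence "cmod (char \<mu> t - char \<nu> t) \<le> 0" for t
  proof (intro LIMSEQ_le_const)
    show "(\<lambda>k. (2/3)^k * C * \<bar>t\<bar>) \<longlonglongrightarrow> 0"
      by (intro tendsto_mult_left_zero LIMSEQ_power_zero) auto
  qed auto
  hence "char \<mu> = char \<nu>" by auto
  with rd show ?thesis by (intro Levy_uniqueness)
qed


section \<open>Existence of a square-integrable solution\<close>

text \<open>Chebyshev: at most a fraction \<open>B / a\<^sup>2\<close> of the mass lies outside \<open>{-a<..a}\<close>.\<close>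
lemma tight_bounded_second_moments:
  assumes "\<And>n. real_distribution (\<mu> n)" "\<And>n. integrable (\<mu> n) (\<lambda>x. x\<^sup>2)"
    and "\<And>n. integral\<^sup>L (\<mu> n) (\<lambda>x. x\<^sup>2) \<le> B"
  shows "tight \<mu>"
  unfolding tight_def
proof (intro conjI allI impI assms(1))
  fix \<epsilon> :: real assume \<epsilon>: "\<epsilon> > 0"
  have "0 \<le> integral\<^sup>L (\<mu> 0) (\<lambda>x. x\<^sup>2)" by simp
  with assms(3)[of 0] have "B \<ge> 0" by linarith
  define a where "a = sqrt ((B + 1) / \<epsilon>)"
  have "(B + 1) / \<epsilon> > 0" using \<epsilon> \<open>B \<ge> 0\<close> by simp
  hence a: "a > 0" "a\<^sup>2 = (B + 1) / \<epsilon>" by (simp_all add: a_def)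
  have "measure (\<mu> n) {-a<..a} > 1 - \<epsilon>" for n
  proof -
    interpret M: real_distribution "\<mu> n" by fact
    have "M.prob {x \<in> space (\<mu> n). a\<^sup>2 \<le> x\<^sup>2} \<le> M.expectation (\<lambda>x. x\<^sup>2) / a\<^sup>2"
      by (rule integral_Markov_inequality_measure[where A = "{}"]) (use assms(2) a(1) in auto)
    also have "\<dots> \<le> B / a\<^sup>2" by (intro divide_right_mono assms zero_le_power2)
    also have "\<dots> = \<epsilon> * (B / (B + 1))" using \<epsilon> \<open>B \<ge> 0\<close> by (simp add: a)
    also have "\<dots> < \<epsilon>" using \<epsilon> \<open>B \<ge> 0\<close> by (simp add: field_simps)
    finally have *: "M.prob {x \<in> space (\<mu> n). a\<^sup>2 \<le> x\<^sup>2} < \<epsilon>" .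
    have "1 - M.prob {-a<..a} = M.prob (space (\<mu> n) - {-a<..a})" by (subst M.prob_compl) auto
    also have "\<dots> \<le> M.prob {x \<in> space (\<mu> n). a\<^sup>2 \<le> x\<^sup>2}"
    proof (rule M.finite_measure_mono)
      have "a\<^sup>2 \<le> x\<^sup>2" if "\<not> (- a < x \<and> x \<le> a)" for x
      proof -
        have "\<bar>a\<bar> \<le> \<bar>x\<bar>" using that a by auto
        thus ?thesis by (rule abs_le_square_iff[THEN iffD1])
      qed
      thus "space (\<mu> n) - {-a<..a} \<subseteq> {x \<in> space (\<mu> n). a\<^sup>2 \<le> x\<^sup>2}" by auto
    qed auto
    finally show ?thesis using * by simp
  qed
  thus "\<exists>a b. a < b \<and> (\<forall>n. 1 - \<epsilon> < measure (\<mu> n) {a<..b})"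
    using a by (intro exI[of _ "-a"] exI[of _ a]) auto
qed

text \<open>Skorohod's representation makes the convergence pointwise, and Fatou's lemma applies.\<close>
lemma weak_limit_integrable_square:
  assumes "\<And>n. real_distribution (\<mu> n)" "real_distribution \<nu>" "weak_conv_m \<mu> \<nu>"
    and "\<And>n. integrable (\<mu> n) (\<lambda>x. x\<^sup>2)" "\<And>n. integral\<^sup>L (\<mu> n) (\<lambda>x. x\<^sup>2) \<le> B"
  shows "integrable \<nu> (\<lambda>x. x\<^sup>2)"
proof -
  obtain \<Omega> :: "real measure" and Yn Y where
    "prob_space \<Omega>" and [measurable]: "\<And>n. Yn n \<in> borel_measurable \<Omega>" and
    dn: "\<And>n. distr \<Omega> borel (Yn n) = \<mu> n" and [measurable]: "Y \<in> borel_measurable \<Omega>" and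
    d: "distr \<Omega> borel Y = \<nu>" and lim: "\<And>x::real. x \<in> space \<Omega> \<Longrightarrow> (\<lambda>n. Yn n x) \<longlonglongrightarrow> Y x"
    using Skorohod[OF assms(1-3)] by force
  have *: "(\<integral>\<^sup>+x. ennreal ((Yn n x)\<^sup>2) \<partial>\<Omega>) \<le> ennreal B" for n
  proof -
    have "(\<integral>\<^sup>+x. ennreal ((Yn n x)\<^sup>2) \<partial>\<Omega>) = (\<integral>\<^sup>+x. ennreal (x\<^sup>2) \<partial>\<mu> n)"
      by (simp add: nn_integral_distr flip: dn)
    also have "\<dots> = ennreal (integral\<^sup>L (\<mu> n) (\<lambda>x. x\<^sup>2))"
      by (rule nn_integral_eq_integral) (auto intro: assms)
    finally show ?thesis using assms(5) by (simp add: ennreal_leI)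
  qed
  have "(\<integral>\<^sup>+x. ennreal ((Y x)\<^sup>2) \<partial>\<Omega>) = (\<integral>\<^sup>+x. liminf (\<lambda>n. ennreal ((Yn n x)\<^sup>2)) \<partial>\<Omega>)"
  proof (rule nn_integral_cong)
    fix x assume "x \<in> space \<Omega>"
    hence "(\<lambda>n. ennreal ((Yn n x)\<^sup>2)) \<longlonglongrightarrow> ennreal ((Y x)\<^sup>2)"
      by (intro tendsto_intros lim)
    thus "ennreal ((Y x)\<^sup>2) = liminf (\<lambda>n. ennreal ((Yn n x)\<^sup>2))"
      by (rule lim_imp_Liminf[OF sequentially_bot, symmetric])
  qed
  also have "\<dots> \<le> liminf (\<lambda>n. \<integral>\<^sup>+x. ennreal ((Yn n x)\<^sup>2) \<partial>\<Omega>)"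
    by (rule nn_integral_liminf) auto
  also have "\<dots> \<le> ennreal B" by (rule Liminf_le) (auto intro!: always_eventually *)
  finally have "(\<integral>\<^sup>+x. ennreal ((Y x)\<^sup>2) \<partial>\<Omega>) < \<infinity>" by (simp add: le_less_trans)
  hence "integrable \<Omega> (\<lambda>x. (Y x)\<^sup>2)"
    by (intro integrableI_nonneg) auto
  moreover have "integrable (distr \<Omega> borel Y) (\<lambda>x. x\<^sup>2) \<longleftrightarrow> integrable \<Omega> (\<lambda>x. (Y x)\<^sup>2)"
    by (rule integrable_distr_eq) measurable
  ultimately show ?thesis by (simp only: d)
qed

text \<open>Iterate \<open>rhs_law\<close> and take a weak limit \<open>\<mu>\<close> along a subsequence. The characteristic functions of
  the iterates converge to that of \<open>\<mu>\<close>, and those of their successors to that of \<open>rhs_law \<mu>\<close>. By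
  contraction, successive iterates become arbitrarily close, so the two limits agree.\<close>
lemma square_integrable_fixed_point_exists:
  "\<exists>\<mu>. finite_mean_solution \<mu> \<and> integrable \<mu> (\<lambda>x. x\<^sup>2)"
proof -
  define law where "law k = (rhs_law ^^ k) (return borel (1::real))" for k
  have law_Suc: "law (Suc k) = rhs_law (law k)" for k by (simp add: law_def)
  have base: "has_bochner_integral (return borel (1::real)) (\<lambda>x. f x) (f 1)" 
    if "f \<in> borel_measurable borel" for f :: "real \<Rightarrow> real"
  proof -
    have "integrable (return borel (1::real)) f"
      by (rule integrableI_bounded) (use that in \<open>auto simp: nn_integral_return\<close>)
    thus ?thesis using that by (simp add: has_bochner_integral_iff integral_return)
  qed
  \<comment> \<open>The map preserves mean 1 and sends a second moment \<open>s\<close> to \<open>2/5 s + 13/20\<close>, with fixed point \<open>13/12\<close>.\<close>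
  have law: "real_distribution (law k) \<and> has_bochner_integral (law k) (\<lambda>x. x) 1 \<and>
     integrable (law k) (\<lambda>x. x\<^sup>2) \<and> integral\<^sup>L (law k) (\<lambda>x. x\<^sup>2) \<le> 13/12" for k
  proof (induction k)
    case 0
    have "real_distribution (return borel (1::real))"
      by (intro real_distribution.intro prob_space_return real_distribution_axioms.intro) auto
    thus ?case using base[of "\<lambda>x. x"] base[of "\<lambda>x. x\<^sup>2"] by (simp add: law_def has_bochner_integral_iff)
  next
    case (Suc k)
    hence m: "integral\<^sup>L (law k) (\<lambda>x. x) = 1" by (simp add: has_bochner_integral_iff)
    have "real_distribution (law k)" "integrable (law k) (\<lambda>x. x\<^sup>2)" using Suc by auto
    from rhs_law_moments[OF this] real_distribution_rhs_law[OF this(1)] Suc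
    show ?case by (simp add: law_Suc m has_bochner_integral_iff)
  qed
  have rd: "real_distribution (law k)" and i1: "integrable (law k) (\<lambda>x. x)"
    and i2: "integrable (law k) (\<lambda>x. x\<^sup>2)"
    and s: "integral\<^sup>L (law k) (\<lambda>x. x\<^sup>2) \<le> 13/12" for k
    using law[of k] unfolding has_bochner_integral_iff by blast+
  have "tight law"
    by (rule tight_bounded_second_moments[where B = "13/12"]) (rule rd i2 s)+
  from tight_imp_convergent_subsubsequence[OF this strict_mono_id]
  obtain r \<mu> where r: "strict_mono (r :: nat \<Rightarrow> nat)" and \<mu>: "real_distribution \<mu>" and
    "weak_conv_m (law \<circ> id \<circ> r) \<mu>" by metis
  hence w: "weak_conv_m (\<lambda>k. law (r k)) \<mu>" by (simp add: o_def)
  have i\<mu>: "integrable \<mu> (\<lambda>x. x\<^sup>2)"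
    by (rule weak_limit_integrable_square[OF rd \<mu> w i2 s])
  interpret M: real_distribution \<mu> by fact
  have conv: "(\<lambda>k. char (law (r k)) t) \<longlonglongrightarrow> char \<mu> t" for t
    by (rule levy_continuity1[OF rd \<mu> w])
  have conv_Suc: "(\<lambda>k. char (law (Suc (r k))) t) \<longlonglongrightarrow> char (rhs_law \<mu>) t" for t
    unfolding law_Suc char_rhs_law[OF rd] char_rhs_law[OF \<mu>]
  proof (rule integral_dominated_convergence[where w = "\<lambda>_. 1"])
    interpret U: prob_space unif by (rule prob_space_unif)
    show "integrable unif (\<lambda>_. 1 :: real)" by simp
    show "split_integrand (char \<mu>) t \<in> borel_measurable unif"
      by (rule borel_measurable_integrable[OF unif_integral(1)[OF M.continuous_split_integrand]])
    show "split_integrand (char (law (r k))) t \<in> borel_measurable unif" for k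
      by (rule borel_measurable_integrable[OF unif_integral(1)[OF real_distribution.continuous_split_integrand[OF rd]]])
    show "AE u in unif. (\<lambda>k. split_integrand (char (law (r k))) t u) \<longlonglongrightarrow> split_integrand (char \<mu>) t u"
      unfolding split_integrand_def by (intro AE_I2 tendsto_intros conv)
    show "AE u in unif. norm (split_integrand (char (law (r k))) t u) \<le> 1" for k
      unfolding split_integrand_def
      by (auto simp: norm_mult intro!: AE_I2 mult_le_one real_distribution.cmod_char_le_1[OF rd])
  qed
  define C where "C = integral\<^sup>L (law 1) (\<lambda>x. \<bar>x\<bar>) + integral\<^sup>L (law 0) (\<lambda>x. \<bar>x\<bar>)"
  have diff: "cmod (char (law (Suc k)) t - char (law k) t) \<le> (2/3)^k * C * \<bar>t\<bar>" for k t
  proof (induction k arbitrary: t)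
    case 0
    show ?case using char_diff_le_abs_means[OF rd i1 rd i1, of 1 t 0] by (simp add: C_def)
  next
    case (Suc k)
    from char_rhs_law_contraction[OF rd rd Suc] show ?case by (simp add: law_Suc mult_ac)
  qed
  have "char (rhs_law \<mu>) t = char \<mu> t" for t
  proof -
    have "(\<lambda>k. (2/3)^r k * C * \<bar>t\<bar>) \<longlonglongrightarrow> 0"
      by (intro tendsto_mult_left_zero LIMSEQ_subseq_LIMSEQ[OF LIMSEQ_power_zero r, unfolded o_def]) auto
    hence "(\<lambda>k. char (law (Suc (r k))) t - char (law (r k)) t) \<longlonglongrightarrow> 0"
      by (rule Lim_null_comparison[OF always_eventually[OF allI[OF diff]]])
    moreover have "(\<lambda>k. char (law (Suc (r k))) t - char (law (r k)) t) \<longlonglongrightarrow> char (rhs_law \<mu>) t - char \<mu> t"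
      by (intro tendsto_diff conv conv_Suc)
    ultimately have "char (rhs_law \<mu>) t - char \<mu> t = 0"
      using LIMSEQ_unique by blast
    thus ?thesis by simp
  qed
  hence "rhs_law \<mu> = \<mu>"
    by (intro Levy_uniqueness real_distribution_rhs_law \<mu>) auto
  moreover have "integrable \<mu> (\<lambda>x. x)"
    by (rule M.square_integrable_imp_integrable) (use i\<mu> in auto)
  ultimately show ?thesis using \<mu> i\<mu> unfolding finite_mean_solution_def by metis
qed

lemma finite_mean_solution_moments:
  assumes "finite_mean_solution \<mu>" "integrable \<mu> (\<lambda>x. x\<^sup>2)"
  shows "integral\<^sup>L \<mu> (\<lambda>x. x) = 1" "integral\<^sup>L \<mu> (\<lambda>x. x\<^sup>2) = 13/12"
proof -
  have rd: "real_distribution \<mu>" and f: "rhs_law \<mu> = \<mu>"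
    using assms unfolding finite_mean_solution_def by metis+
  note m = rhs_law_moments[OF rd assms(2), unfolded f has_bochner_integral_iff, THEN conjunct2]
  show 1: "integral\<^sup>L \<mu> (\<lambda>x. x) = 1" using m(1) by simp
  show "integral\<^sup>L \<mu> (\<lambda>x. x\<^sup>2) = 13/12" using m(2) by (simp add: 1)
qed

section \<open>The recursion for the number of inversions\<close>

text \<open>An error pattern: \<open>f y\<close> says whether the comparison of \<open>y\<close> with the pivot errs.\<close>
abbreviation coin_flips :: "'a set \<Rightarrow> real \<Rightarrow> ('a \<Rightarrow> bool) pmf" where
  "coin_flips A p \<equiv> Pi_pmf A False (\<lambda>_. bernoulli_pmf p)"

text \<open>Drawing all the errors first, as a function on the set of elements, makes them visibly independent
  of the order of the list.\<close>
lemma noisy_partition_eq_coin_flips: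
  assumes "distinct ys"
  shows "noisy_partition p x ys =
    map_pmf (\<lambda>f. partition (\<lambda>y. (y < x) \<noteq> f y) ys) (coin_flips (set ys) p)"
  using assms
proof (induction ys)
  case (Cons y ys)
  have *: "partition (\<lambda>z. (z < x) \<noteq> (f(y := e)) z) (y # ys) = 
      (case partition (\<lambda>z. (z < x) \<noteq> f z) ys of (ls, rs) \<Rightarrow> if (y < x) \<noteq> e then (y # ls, rs) else (ls, y # rs))"
    for f :: "'a \<Rightarrow> bool" and e
  proof -
    have "filter (\<lambda>z. (z < x) \<noteq> (f(y := e)) z) ys = filter (\<lambda>z. (z < x) \<noteq> f z) ys"
         "filter (Not \<circ> (\<lambda>z. (z < x) \<noteq> (f(y := e)) z)) ys = filter (Not \<circ> (\<lambda>z. (z < x) \<noteq> f z)) ys"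
      using Cons.prems by (auto intro!: filter_cong)
    thus ?thesis by (simp add: o_def)
  qed
  have "noisy_partition p x (y # ys) = bernoulli_pmf p \<bind> (\<lambda>e. coin_flips (set ys) p \<bind> (\<lambda>f.
      return_pmf (case partition (\<lambda>z. (z < x) \<noteq> f z) ys of (ls, rs) \<Rightarrow> 
        if (y < x) \<noteq> e then (y # ls, rs) else (ls, y # rs))))"
    using Cons by (simp add: map_pmf_def bind_assoc_pmf bind_return_pmf)
  also have "\<dots> = bernoulli_pmf p \<bind> (\<lambda>e. coin_flips (set ys) p \<bind> (\<lambda>f.
      return_pmf (partition (\<lambda>z. (z < x) \<noteq> (f(y := e)) z) (y # ys))))"
    unfolding * ..
  also have "\<dots> = map_pmf (\<lambda>f. partition (\<lambda>z. (z < x) \<noteq> f z) (y # ys)) (coin_flips (set (y # ys)) p)"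
    using Cons.prems
    by (simp add: Pi_pmf_insert' map_pmf_def bind_assoc_pmf bind_return_pmf del: fun_upd_apply partition.simps partition_filter_conv)
  finally show ?case .
qed (simp add: map_pmf_def bind_return_pmf)

lemma mset_noisy_partition:
  "(ls, rs) \<in> set_pmf (noisy_partition p x ys) \<Longrightarrow> mset ls + mset rs = mset ys"
  by (induction ys arbitrary: ls rs) (fastforce split: if_splits)+

lemma mset_noisy_quicksort:
  "ys \<in> set_pmf (noisy_quicksort p xs) \<Longrightarrow> mset ys = mset xs"
proof (induction p xs arbitrary: ys rule: noisy_quicksort.induct)
  case (2 p x xs)
  from "2.prems" obtain ls rs l r where 
    p: "(ls, rs) \<in> set_pmf (noisy_partition p x xs)" and
    l: "l \<in> set_pmf (noisy_quicksort p ls)" and r: "r \<in> set_pmf (noisy_quicksort p rs)" and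
    ys: "ys = l @ x # r" by auto
  have "mset l = mset ls" by (rule "2.IH"(1)[OF p refl l])
  moreover have "mset r = mset rs" by (rule "2.IH"(2)[OF p refl l r])
  ultimately show ?case using mset_noisy_partition[OF p] by (simp add: ys)
qed simp

definition cross_inversions :: "'a::linorder set \<Rightarrow> 'a set \<Rightarrow> nat" where
  "cross_inversions L R = card {(a, b). a \<in> L \<and> b \<in> R \<and> b < a}"

lemma cross_inversions_insert:
  assumes "finite L" "finite R" "a \<notin> L"
  shows "cross_inversions (insert a L) R = card {b \<in> R. b < a} + cross_inversions L R"
proof -
  have fin: "finite {(a', b). a' \<in> L \<and> b \<in> R \<and> b < a'}"
    by (rule finite_subset[of _ "L \<times> R"]) (use assms in auto)
  have "{(a', b). a' \<in> insert a L \<and> b \<in> R \<and> b < a'} =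
      Pair a ` {b \<in> R. b < a} \<union> {(a', b). a' \<in> L \<and> b \<in> R \<and> b < a'}" by auto
  also have "card \<dots> = card (Pair a ` {b \<in> R. b < a}) + cross_inversions L R"
    unfolding cross_inversions_def using assms fin by (intro card_Un_disjoint) auto
  finally show ?thesis by (simp add: cross_inversions_def card_image inj_on_def)
qed

lemma inversions_Cons: "inversions (x # xs) = length (filter (\<lambda>y. y < x) xs) + inversions xs"
proof -
  let ?I = "{(i, j). i < j \<and> j < length xs \<and> xs ! i > xs ! j}"
  have fin: "finite ?I" by (rule finite_subset[of _ "{..<length xs} \<times> {..<length xs}"]) auto
  have eq: "{(i, j). i < j \<and> j < length (x # xs) \<and> (x # xs) ! i > (x # xs) ! j} =
      (\<lambda>j. (0, Suc j)) ` {j. j < length xs \<and> xs ! j < x} \<union> map_prod Suc Suc ` ?I" (is "?L = ?H \<union> ?T")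
  proof (intro equalityI subsetI)
    fix z assume z: "z \<in> ?L"
    then obtain i j' where ij: "z = (i, Suc j')" by (cases z) (auto simp: less_Suc_eq_0_disj)
    show "z \<in> ?H \<union> ?T"
    proof (cases i)
      case 0
      thus ?thesis using z ij by simp
    next
      case (Suc i')
      with z ij have "(i', j') \<in> ?I" "z = map_prod Suc Suc (i', j')" by simp_all
      thus ?thesis by blast
    qed
  next
    fix z assume "z \<in> ?H \<union> ?T"
    thus "z \<in> ?L" by (elim UnE imageE) auto
  qed
  have "card ?L = card ?H + card ?T"
    unfolding eq using fin by (intro card_Un_disjoint) auto
  also have "card ?H = length (filter (\<lambda>y. y < x) xs)"
    by (simp add: length_filter_conv_card card_image inj_on_def)
  also have "card ?T = inversions xs"
    unfolding inversions_def by (intro card_image) (auto simp: inj_on_def)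
  finally show ?thesis unfolding inversions_def .
qed

lemma inversions_append:
  assumes "distinct (xs @ ys)"
  shows "inversions (xs @ ys) = inversions xs + inversions ys + cross_inversions (set xs) (set ys)"
  using assms
proof (induction xs)
  case Nil
  show ?case by (simp add: inversions_def cross_inversions_def)
next
  case (Cons x xs)
  have "length (filter (\<lambda>y. y < x) ys) = card {y \<in> set ys. y < x}"
    using Cons.prems distinct_card[of "filter (\<lambda>y. y < x) ys"] by simp
  with Cons show ?case by (simp add: inversions_Cons cross_inversions_insert)
qed

text \<open>The pivot is inserted on both sides so that one count covers the inversions between the sublists as
  well as those between the pivot and either sublist.\<close>
lemma inversions_append_Cons:
  assumes "distinct (xs @ x # ys)"
  shows "inversions (xs @ x # ys) = inversions xs + inversions ys +
     cross_inversions (insert x (set xs)) (insert x (set ys))"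
proof -
  have "length (filter (\<lambda>y. y < x) ys) = card {y \<in> set ys. y < x}"
    using assms distinct_card[of "filter (\<lambda>y. y < x) ys"] by simp
  moreover have "{y. (y = x \<or> y \<in> set ys) \<and> y < x} = {y \<in> set ys. y < x}" by auto
  ultimately show ?thesis using assms inversions_append[OF assms]
    by (simp add: inversions_Cons cross_inversions_insert)
qed

definition declared_small :: "'a::linorder set \<Rightarrow> 'a \<Rightarrow> ('a \<Rightarrow> bool) \<Rightarrow> 'a set" where
  "declared_small A x f = {y \<in> A - {x}. (y < x) \<noteq> f y}"

definition declared_large :: "'a::linorder set \<Rightarrow> 'a \<Rightarrow> ('a \<Rightarrow> bool) \<Rightarrow> 'a set" where
  "declared_large A x f = {y \<in> A - {x}. (y < x) = f y}"

definition inv_char :: "'a::linorder set \<Rightarrow> real \<Rightarrow> real \<Rightarrow> complex" where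
  "inv_char A p \<theta> = measure_pmf.expectation (inversions_pmf A p) (\<lambda>i. iexp (\<theta> * real i))"

text \<open>Real and imaginary parts reduce this to the real case.\<close>
lemma expectation_bind_pmf:
  fixes h :: "'b \<Rightarrow> complex"
  assumes h: "\<And>x. cmod (h x) \<le> B"
  shows "measure_pmf.expectation (bind_pmf M f) h = measure_pmf.expectation M (\<lambda>x. measure_pmf.expectation (f x) h)"
proof -
  have int: "integrable (measure_pmf N) h" for N :: "'b pmf"
    by (rule measure_pmf.integrable_const_bound[where B = B]) (auto simp: h)
  have "0 \<le> B" using order_trans[OF norm_ge_zero h] .
  have "cmod (measure_pmf.expectation N h) \<le> B" for N
    by (rule order_trans[OF integral_norm_bound measure_pmf.integral_le_const]) (auto simp: h int)
  hence int': "integrable M (\<lambda>x. measure_pmf.expectation (f x) h)"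
    by (intro measure_pmf.integrable_const_bound[where B = B]) auto
  have *: "measure_pmf.expectation (bind_pmf M f) g = measure_pmf.expectation M (\<lambda>x. measure_pmf.expectation (f x) g)"
    if "\<And>x. \<bar>g x\<bar> \<le> B" for g :: "'b \<Rightarrow> real"
    unfolding measure_pmf_bind
  proof (rule integral_bind[where K = "count_space UNIV" and B = B and B' = 1])
    show "(\<lambda>x. measure_pmf (f x)) \<in> measure_pmf M \<rightarrow>\<^sub>M subprob_algebra (count_space UNIV)"
      using measurable_measure_pmf[of f] by simp
  qed (auto simp: that measure_pmf.emeasure_space_1 measure_pmf.finite_measure simp del: space_measure_pmf)
  have "\<bar>Re (h x)\<bar> \<le> B" "\<bar>Im (h x)\<bar> \<le> B" for x
    using h[of x] abs_Re_le_cmod[of "h x"] abs_Im_le_cmod[of "h x"] by linarith+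
  from *[OF this(1)] *[OF this(2)] show ?thesis
    by (simp add: complex_eq_iff int int' integral_Re[symmetric] integral_Im[symmetric] del: integral_Re integral_Im)
qed

text \<open>The error pattern and the order of the remaining elements are independent, so the pattern may be
  drawn first. For a fixed pattern, partitioning a random permutation yields two independent random
  permutations of the two parts, which is again the situation of \<open>inversions_pmf\<close>. Sorting a part
  only permutes it, so the cross inversions depend on the two parts alone.\<close>
lemma inversions_pmf_rec:
  fixes A :: "'a::linorder set"
  assumes "finite A" "A \<noteq> {}"
  shows "inversions_pmf A p = do {
     x \<leftarrow> pmf_of_set A;
     f \<leftarrow> coin_flips (A - {x}) p;
     i \<leftarrow> inversions_pmf (declared_small A x f) p;
     j \<leftarrow> inversions_pmf (declared_large A x f) p;
     return_pmf (i + j + cross_inversions (insert x (declared_small A x f)) (insert x (declared_large A x f)))}"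
proof -
  define sort_split where "sort_split = (\<lambda>(x :: 'a) (ls, rs). do {
     left \<leftarrow> noisy_quicksort p ls; right \<leftarrow> noisy_quicksort p rs; return_pmf (inversions (left @ x # right))})"
  have split: "pmf_of_set (permutations_of_set (A - {x})) \<bind> (\<lambda>zs. noisy_partition p x zs \<bind> sort_split x) =
     coin_flips (A - {x}) p \<bind> (\<lambda>f. inversions_pmf (declared_small A x f) p \<bind> (\<lambda>i.
       inversions_pmf (declared_large A x f) p \<bind> (\<lambda>j. return_pmf (i + j + 
       cross_inversions (insert x (declared_small A x f)) (insert x (declared_large A x f))))))"
    if x: "x \<in> A" for x
  proof -
    have "pmf_of_set (permutations_of_set (A - {x})) \<bind> (\<lambda>zs. noisy_partition p x zs \<bind> sort_split x) =
       pmf_of_set (permutations_of_set (A - {x})) \<bind> (\<lambda>zs. coin_flips (A - {x}) p \<bind> 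
          (\<lambda>f. sort_split x (partition (\<lambda>y. (y < x) \<noteq> f y) zs)))"
    proof (intro bind_pmf_cong refl)
      fix zs assume "zs \<in> set_pmf (pmf_of_set (permutations_of_set (A - {x})))"
      hence "distinct zs" "set zs = A - {x}" using assms by (auto dest: permutations_of_setD)
      thus "noisy_partition p x zs \<bind> sort_split x = 
         coin_flips (A - {x}) p \<bind> (\<lambda>f. sort_split x (partition (\<lambda>y. (y < x) \<noteq> f y) zs))"
        by (simp add: noisy_partition_eq_coin_flips map_pmf_def bind_assoc_pmf bind_return_pmf del: partition_filter_conv)
    qed
    also have "\<dots> = coin_flips (A - {x}) p \<bind> (\<lambda>f. 
       map_pmf (partition (\<lambda>y. (y < x) \<noteq> f y)) (pmf_of_set (permutations_of_set (A - {x}))) \<bind> sort_split x)"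
      by (subst bind_commute_pmf) (simp add: map_pmf_def bind_assoc_pmf bind_return_pmf)
    also have "\<dots> = coin_flips (A - {x}) p \<bind> (\<lambda>f. inversions_pmf (declared_small A x f) p \<bind> (\<lambda>i.
       inversions_pmf (declared_large A x f) p \<bind> (\<lambda>j. return_pmf (i + j + 
       cross_inversions (insert x (declared_small A x f)) (insert x (declared_large A x f))))))"
    proof (intro bind_pmf_cong refl)
      fix f
      let ?L = "declared_small A x f" and ?R = "declared_large A x f"
      have LR: "{y \<in> A - {x}. (y < x) \<noteq> f y} = ?L" "{y \<in> A - {x}. \<not> (y < x) \<noteq> f y} = ?R"
        by (auto simp: declared_small_def declared_large_def)
      have fin: "finite ?L" "finite ?R" using assms(1) by (auto simp: declared_small_def declared_large_def)
      have "map_pmf (partition (\<lambda>y. (y < x) \<noteq> f y)) (pmf_of_set (permutations_of_set (A - {x}))) \<bind> sort_split x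
        = pmf_of_set (permutations_of_set ?L) \<bind> (\<lambda>ls. pmf_of_set (permutations_of_set ?R) \<bind> (\<lambda>rs.
            noisy_quicksort p ls \<bind> (\<lambda>left. noisy_quicksort p rs \<bind> (\<lambda>right.
              return_pmf (inversions (left @ x # right))))))"
        using assms LR by (subst partition_random_permutations) 
          (simp_all add: pair_pmf_def bind_assoc_pmf bind_return_pmf sort_split_def)
      also have "\<dots> = pmf_of_set (permutations_of_set ?L) \<bind> (\<lambda>ls. pmf_of_set (permutations_of_set ?R) \<bind> (\<lambda>rs.
            noisy_quicksort p ls \<bind> (\<lambda>left. noisy_quicksort p rs \<bind> (\<lambda>right.
              return_pmf (inversions left + inversions right + cross_inversions (insert x ?L) (insert x ?R))))))"
      proof (intro bind_pmf_cong refl)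
        fix ls rs left right
        assume ls: "ls \<in> set_pmf (pmf_of_set (permutations_of_set ?L))"
          and rs: "rs \<in> set_pmf (pmf_of_set (permutations_of_set ?R))"
          and "left \<in> set_pmf (noisy_quicksort p ls)" "right \<in> set_pmf (noisy_quicksort p rs)"
        hence m: "mset left = mset ls" "mset right = mset rs" by (auto dest: mset_noisy_quicksort)
        have "set ls = ?L" "distinct ls" "set rs = ?R" "distinct rs"
          using ls rs fin by (auto dest: permutations_of_setD)
        hence "set left = ?L" "distinct left" "set right = ?R" "distinct right"
          using m by (metis mset_eq_setD, metis mset_eq_imp_distinct_iff)+
        thus "return_pmf (inversions (left @ x # right)) = 
            return_pmf (inversions left + inversions right + cross_inversions (insert x ?L) (insert x ?R))"
          by (subst inversions_append_Cons) (auto simp: declared_small_def declared_large_def)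
      qed
      also have "\<dots> = pmf_of_set (permutations_of_set ?L) \<bind> (\<lambda>ls. noisy_quicksort p ls \<bind> (\<lambda>left. 
            pmf_of_set (permutations_of_set ?R) \<bind> (\<lambda>rs. noisy_quicksort p rs \<bind> (\<lambda>right.
              return_pmf (inversions left + inversions right + cross_inversions (insert x ?L) (insert x ?R))))))"
        by (subst bind_commute_pmf) (rule refl)
      finally show "map_pmf (partition (\<lambda>y. (y < x) \<noteq> f y)) (pmf_of_set (permutations_of_set (A - {x}))) \<bind> sort_split x
         = inversions_pmf ?L p \<bind> (\<lambda>i. inversions_pmf ?R p \<bind> (\<lambda>j. return_pmf (i + j + 
             cross_inversions (insert x ?L) (insert x ?R))))"
        by (simp add: inversions_pmf_def bind_assoc_pmf bind_return_pmf)
    qed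
    finally show ?thesis .
  qed
  have "inversions_pmf A p = pmf_of_set A \<bind> (\<lambda>x. pmf_of_set (permutations_of_set (A - {x})) \<bind> 
     (\<lambda>zs. noisy_partition p x zs \<bind> sort_split x))"
    unfolding inversions_pmf_def
    by (subst random_permutation_of_set[OF assms])
       (simp add: bind_assoc_pmf bind_return_pmf sort_split_def split_beta')
  also have "\<dots> = pmf_of_set A \<bind> (\<lambda>x. coin_flips (A - {x}) p \<bind> (\<lambda>f. inversions_pmf (declared_small A x f) p \<bind> (\<lambda>i.
       inversions_pmf (declared_large A x f) p \<bind> (\<lambda>j. return_pmf (i + j + 
       cross_inversions (insert x (declared_small A x f)) (insert x (declared_large A x f)))))))"
    using assms by (intro bind_pmf_cong refl split) auto
  finally show ?thesis .
qed

lemma inv_char_rec: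
  assumes "finite A" "A \<noteq> {}"
  shows "inv_char A p \<theta> = (\<Sum>x\<in>A. measure_pmf.expectation (coin_flips (A - {x}) p) (\<lambda>f. 
     inv_char (declared_small A x f) p \<theta> * inv_char (declared_large A x f) p \<theta> *
     iexp (\<theta> * real (cross_inversions (insert x (declared_small A x f)) (insert x (declared_large A x f)))))) / card A"
proof -
  have [simp]: "cmod (iexp (\<theta> * real i)) \<le> 1" for i by simp
  note e = expectation_bind_pmf[where B = 1]
  have i: "measure_pmf.expectation (pmf_of_set A) h = (\<Sum>x\<in>A. h x) / card A" for h :: "'a \<Rightarrow> complex"
    using assms by (subst integral_measure_pmf[of A]) (auto simp: sum_divide_distrib scaleR_conv_of_real field_simps)
  have iexp_sum: "iexp (\<theta> * real (a + b + c)) = iexp (\<theta> * real a) * iexp (\<theta> * real b) * iexp (\<theta> * real c)" for a b c :: nat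
    by (simp add: ring_distribs exp_add)
  show ?thesis unfolding inv_char_def
    by (subst inversions_pmf_rec[OF assms])
       (simp add: e i iexp_sum del: of_real_mult of_nat_add)
qed

section \<open>Random error patterns\<close>

lemma integrable_coin_flips:
  fixes g :: "('a \<Rightarrow> bool) \<Rightarrow> 'b::{banach, second_countable_topology}"
  assumes "finite A"
  shows "integrable (coin_flips A p) g"
  using assms by (intro integrable_measure_pmf_finite) (auto simp: set_Pi_pmf intro!: finite_PiE_dflt)

lemma expectation_coin_flips_insert:
  fixes g :: "('a \<Rightarrow> bool) \<Rightarrow> real"
  assumes "finite A" "x \<notin> A" "0 \<le> p" "p \<le> 1"
  shows "measure_pmf.expectation (coin_flips (insert x A) p) g =
     p * measure_pmf.expectation (coin_flips A p) (\<lambda>f. g (f(x := True))) +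
     (1 - p) * measure_pmf.expectation (coin_flips A p) (\<lambda>f. g (f(x := False)))"
proof -
  have fin: "finite (set_pmf (coin_flips A p))"
    using assms by (auto simp: set_Pi_pmf intro!: finite_PiE_dflt)
  have "coin_flips (insert x A) p = bernoulli_pmf p \<bind> (\<lambda>b. map_pmf (\<lambda>f. f(x := b)) (coin_flips A p))"
    using assms by (simp add: Pi_pmf_insert' map_pmf_def)
  thus ?thesis using assms fin
    by (simp only:, subst pmf_expectation_bind[of UNIV]) (auto simp: UNIV_bool)
qed

lemma expectation_coin_flip:
  assumes "finite A" "y \<in> A" "0 \<le> p" "p \<le> 1"
  shows "measure_pmf.expectation (coin_flips A p) (\<lambda>f. of_bool (f y)) = p"
proof -
  have "measure_pmf.expectation (coin_flips A p) (\<lambda>f. of_bool (f y) :: real) = 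
     measure_pmf.expectation (map_pmf (\<lambda>f. f y) (coin_flips A p)) of_bool" by simp
  also have "map_pmf (\<lambda>f. f y) (coin_flips A p) = bernoulli_pmf p"
    using assms by (simp add: Pi_pmf_component)
  finally show ?thesis using assms by simp
qed

lemma variance_coin_flips:
  fixes w :: "'a \<Rightarrow> real"
  assumes "finite A" "0 \<le> p" "p \<le> 1"
  shows "measure_pmf.expectation (coin_flips A p) (\<lambda>f. (\<Sum>y\<in>A. w y * (of_bool (f y) - p))\<^sup>2)
     = p * (1 - p) * (\<Sum>y\<in>A. (w y)\<^sup>2)"
  using assms(1)
proof (induction A)
  case (insert x A)
  let ?S = "\<lambda>f. \<Sum>y\<in>A. w y * (of_bool (f y) - p)"
  have *: "(\<Sum>y\<in>A. w y * (of_bool ((f(x := b)) y) - p)) = ?S f" for f b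
    using insert.hyps by (intro sum.cong) auto
  have i: "integrable (coin_flips A p) g" for g :: "_ \<Rightarrow> real"
    using insert.hyps by (intro integrable_coin_flips)
  have "measure_pmf.expectation (coin_flips (insert x A) p) (\<lambda>f. (\<Sum>y\<in>insert x A. w y * (of_bool (f y) - p))\<^sup>2)
    = p * measure_pmf.expectation (coin_flips A p) (\<lambda>f. (w x * (1 - p) + ?S f)\<^sup>2) +
     (1 - p) * measure_pmf.expectation (coin_flips A p) (\<lambda>f. (w x * (0 - p) + ?S f)\<^sup>2)"
    using insert.hyps by (subst expectation_coin_flips_insert) (simp_all add: assms * del: fun_upd_apply, simp)
  also have "\<dots> = measure_pmf.expectation (coin_flips A p) (\<lambda>f. p * (w x * (1 - p) + ?S f)\<^sup>2 + (1 - p) * (w x * (0 - p) + ?S f)\<^sup>2)"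
    using i by simp
  also have "\<dots> = measure_pmf.expectation (coin_flips A p) (\<lambda>f. (?S f)\<^sup>2 + p * (1 - p) * (w x)\<^sup>2)"
    by (intro Bochner_Integration.integral_cong refl) (simp add: power2_eq_square algebra_simps)
  also have "\<dots> = p * (1 - p) * (\<Sum>y\<in>insert x A. (w y)\<^sup>2)"
    using i insert by (simp add: algebra_simps)
  finally show ?case .
qed simp

text \<open>Cauchy and Schwarz, in the form that the variance of the absolute value is nonnegative.\<close>
lemma abs_deviation_coin_flips:
  fixes w :: "'a \<Rightarrow> real"
  assumes "finite A" "0 \<le> p" "p \<le> 1"
  shows "measure_pmf.expectation (coin_flips A p) (\<lambda>f. \<bar>\<Sum>y\<in>A. w y * (of_bool (f y) - p)\<bar>)
     \<le> sqrt (p * (\<Sum>y\<in>A. (w y)\<^sup>2))"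
proof (rule real_le_rsqrt)
  let ?Z = "\<lambda>f. \<bar>\<Sum>y\<in>A. w y * (of_bool (f y) - p)\<bar>"
  note i = integrable_coin_flips[OF assms(1)]
  have "0 \<le> measure_pmf.variance (coin_flips A p) ?Z" by simp
  also have "\<dots> = measure_pmf.expectation (coin_flips A p) (\<lambda>f. (?Z f)\<^sup>2) - (measure_pmf.expectation (coin_flips A p) ?Z)\<^sup>2"
    by (rule measure_pmf.variance_eq) (rule i)+
  also have "measure_pmf.expectation (coin_flips A p) (\<lambda>f. (?Z f)\<^sup>2) = p * (1 - p) * (\<Sum>y\<in>A. (w y)\<^sup>2)"
    using variance_coin_flips[OF assms] by simp
  also have "\<dots> \<le> p * 1 * (\<Sum>y\<in>A. (w y)\<^sup>2)"
    using assms by (intro mult_right_mono mult_left_mono sum_nonneg) auto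
  finally show "(measure_pmf.expectation (coin_flips A p) ?Z)\<^sup>2 \<le> p * (\<Sum>y\<in>A. (w y)\<^sup>2)" by simp
qed

lemma card_errors: "finite A \<Longrightarrow> real (card {y \<in> A. f y}) = (\<Sum>y\<in>A. of_bool (f y))"
  by (simp add: of_bool_def sum.If_cases Int_def)

text \<open>The second bound controls the ordered pairs of distinct misjudged elements; each such pair has
  probability \<open>p\<^sup>2\<close>.\<close>
lemma expectation_errors:
  assumes "finite A" "0 \<le> p" "p \<le> 1"
  defines "e \<equiv> \<lambda>f. real (card {y \<in> A. f y})"
  shows "measure_pmf.expectation (coin_flips A p) e = p * card A"
    and "measure_pmf.expectation (coin_flips A p) (\<lambda>f. e f * (e f - 1)) \<le> (p * card A)\<^sup>2"
proof -
  have i: "integrable (coin_flips A p) g" for g :: "('a \<Rightarrow> bool) \<Rightarrow> real"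
    using assms(1) by (rule integrable_coin_flips)
  show *: "measure_pmf.expectation (coin_flips A p) e = p * card A"
    unfolding e_def card_errors[OF assms(1)] using assms
    by (subst Bochner_Integration.integral_sum) (auto simp: expectation_coin_flip intro: i)
  have "e f - p * card A = (\<Sum>y\<in>A. 1 * (of_bool (f y) - p))" for f
    by (simp add: e_def card_errors assms(1) sum_subtractf)
  hence "measure_pmf.expectation (coin_flips A p) (\<lambda>f. (e f - p * card A)\<^sup>2) = p * (1 - p) * card A"
    using variance_coin_flips[OF assms(1-3), of "\<lambda>_. 1"] by simp
  moreover have "e f * (e f - 1) = (e f - p * card A)\<^sup>2 + (2 * p * card A - 1) * e f - (p * card A)\<^sup>2" for f
    by (simp add: power2_eq_square algebra_simps)
  moreover have "measure_pmf.expectation (coin_flips A p) (\<lambda>f. X f + c * e f - d) =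
     measure_pmf.expectation (coin_flips A p) X + c * (p * card A) - d" for X :: "('a \<Rightarrow> bool) \<Rightarrow> real" and c d
    using i by (simp add: *)
  ultimately have "measure_pmf.expectation (coin_flips A p) (\<lambda>f. e f * (e f - 1)) =
     p * (1 - p) * card A + (2 * p * card A - 1) * (p * card A) - (p * card A)\<^sup>2"
    by presburger
  also have "\<dots> = (p * card A)\<^sup>2 - p * p * card A" by (simp add: power2_eq_square algebra_simps)
  also have "\<dots> \<le> (p * card A)\<^sup>2" using assms by simp
  finally show "measure_pmf.expectation (coin_flips A p) (\<lambda>f. e f * (e f - 1)) \<le> (p * card A)\<^sup>2" .
qed


section \<open>Inversions caused by one partitioning step\<close>

text \<open>The rank is a bijection from \<open>A\<close> to the numbers below its cardinality.\<close>
lemma sum_rank: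
  fixes A :: "'a::linorder set" and h :: "nat \<Rightarrow> 'b::comm_monoid_add"
  assumes "finite A"
  shows "(\<Sum>x\<in>A. h (card {y \<in> A. y < x})) = (\<Sum>k<card A. h k)"
  using assms
proof (induction rule: finite_linorder_max_induct)
  case (insert b A)
  have "b \<notin> A" using insert.hyps by auto
  have 1: "{y \<in> insert b A. y < b} = A" using insert.hyps by auto
  have 2: "{y \<in> insert b A. y < x} = {y \<in> A. y < x}" if "x \<in> A" for x using insert.hyps that by force
  have "(\<Sum>x\<in>A. h (card {y \<in> insert b A. y < x})) = (\<Sum>x\<in>A. h (card {y \<in> A. y < x}))"
    by (intro sum.cong refl) (simp only: 2)
  thus ?case using insert \<open>b \<notin> A\<close> by (simp add: 1[simplified] add.commute)
qed simp

lemma sum_rank_descending: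
  fixes A :: "'a::linorder set" and h :: "nat \<Rightarrow> 'b::comm_monoid_add"
  assumes "finite A"
  shows "(\<Sum>x\<in>A. h (card {y \<in> A. x < y})) = (\<Sum>k<card A. h k)"
  using assms
proof (induction rule: finite_linorder_min_induct)
  case (insert b A)
  have "b \<notin> A" using insert.hyps by auto
  have 1: "{y \<in> insert b A. b < y} = A" using insert.hyps by auto
  have 2: "{y \<in> insert b A. x < y} = {y \<in> A. x < y}" if "x \<in> A" for x using insert.hyps that by force
  have "(\<Sum>x\<in>A. h (card {y \<in> insert b A. x < y})) = (\<Sum>x\<in>A. h (card {y \<in> A. x < y}))"
    by (intro sum.cong refl) (simp only: 2)
  thus ?case using insert \<open>b \<notin> A\<close> by (simp add: 1[simplified] add.commute)
qed simp


text \<open>Only a misjudged element can be on the wrong side.\<close>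
lemma card_declared_small_diff:
  assumes "finite A"
  shows "\<bar>real (card (declared_small A x f)) - real (card {y \<in> A. y < x})\<bar> \<le> real (card {y \<in> A - {x}. f y})"
proof -
  let ?D = "declared_small A x f" and ?S = "{y \<in> A. y < x}" and ?E = "{y \<in> A - {x}. f y}"
  have fin: "finite ?D" "finite ?S" "finite ?E" using assms by (auto simp: declared_small_def)
  have "card ?D \<le> card (?S \<union> ?E)" by (intro card_mono) (use fin in \<open>auto simp: declared_small_def\<close>)
  moreover have "card ?S \<le> card (?D \<union> ?E)" by (intro card_mono) (use fin in \<open>auto simp: declared_small_def\<close>)
  ultimately show ?thesis using card_Un_le[of ?S ?E] card_Un_le[of ?D ?E] by linarith
qed

lemma card_declared_large_diff:
  assumes "finite A"
  shows "\<bar>real (card (declared_large A x f)) - real (card {y \<in> A. x < y})\<bar> \<le> real (card {y \<in> A - {x}. f y})"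
proof -
  let ?D = "declared_large A x f" and ?G = "{y \<in> A. x < y}" and ?E = "{y \<in> A - {x}. f y}"
  have fin: "finite ?D" "finite ?G" "finite ?E" using assms by (auto simp: declared_large_def)
  have "card ?D \<le> card (?G \<union> ?E)" by (intro card_mono) (use fin in \<open>auto simp: declared_large_def\<close>)
  moreover have "card ?G \<le> card (?D \<union> ?E)" by (intro card_mono) (use fin in \<open>auto simp: declared_large_def\<close>)
  ultimately show ?thesis using card_Un_le[of ?G ?E] card_Un_le[of ?D ?E] by linarith
qed

text \<open>The elements, pivot \<open>x\<close> included, that form an inversion with \<open>y\<close> if \<open>y\<close> is the only misjudged
  element.\<close>
definition overtaken :: "'a::linorder set \<Rightarrow> 'a \<Rightarrow> 'a \<Rightarrow> 'a set" where
  "overtaken A x y = (if y < x then {a \<in> A. y < a \<and> a \<le> x} else {a \<in> A. x \<le> a \<and> a < y})"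

lemma card_overtaken_le: "finite A \<Longrightarrow> card (overtaken A x y) \<le> card A"
  by (auto simp: overtaken_def intro!: card_mono)

lemma sum_Suc_upto: "(\<Sum>k<n. real k + 1) = real n * (real n + 1) / 2"
  by (induction n) (auto simp: field_simps)

text \<open>A smaller element overtakes, beside the pivot, the elements between itself and the pivot: these
  numbers run through all values below \<open>s\<close>. The larger elements are symmetric.\<close>
lemma sum_overtaken:
  assumes "finite A" "x \<in> A"
  defines "s \<equiv> real (card {y \<in> A. y < x})" and "g \<equiv> real (card {y \<in> A. x < y})"
  shows "(\<Sum>y\<in>A - {x}. real (card (overtaken A x y))) = s * (s + 1) / 2 + g * (g + 1) / 2"
proof -
  let ?S = "{y \<in> A. y < x}" and ?G = "{y \<in> A. x < y}"
  have fin: "finite ?S" "finite ?G" using assms(1) by auto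
  have S: "card (overtaken A x y) = card {a \<in> ?S. y < a} + 1" if "y \<in> ?S" for y
  proof -
    have "overtaken A x y = insert x {a \<in> ?S. y < a}"
      using that assms(2) by (auto simp: overtaken_def)
    thus ?thesis using assms(1) by simp
  qed
  have G: "card (overtaken A x y) = card {a \<in> ?G. a < y} + 1" if "y \<in> ?G" for y
  proof -
    have "overtaken A x y = insert x {a \<in> ?G. a < y}"
      using that assms(2) by (auto simp: overtaken_def)
    thus ?thesis using assms(1) by simp
  qed
  have "A - {x} = ?S \<union> ?G" "?S \<inter> ?G = {}" by auto
  hence "(\<Sum>y\<in>A - {x}. real (card (overtaken A x y))) =
     (\<Sum>y\<in>?S. real (card (overtaken A x y))) + (\<Sum>y\<in>?G. real (card (overtaken A x y)))"
    using fin by (simp only: sum.union_disjoint)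
  also have "(\<Sum>y\<in>?S. real (card (overtaken A x y))) = (\<Sum>y\<in>?S. real (card {a \<in> ?S. y < a}) + 1)"
    by (intro sum.cong refl) (simp only: S of_nat_add of_nat_1)
  also have "\<dots> = s * (s + 1) / 2"
    unfolding sum_rank_descending[OF fin(1), of "\<lambda>k. real k + 1"] sum_Suc_upto s_def ..
  also have "(\<Sum>y\<in>?G. real (card (overtaken A x y))) = (\<Sum>y\<in>?G. real (card {a \<in> ?G. a < y}) + 1)"
    by (intro sum.cong refl) (simp only: G of_nat_add of_nat_1)
  also have "\<dots> = g * (g + 1) / 2"
    unfolding sum_rank[OF fin(2), of "\<lambda>k. real k + 1"] sum_Suc_upto g_def ..
  finally show ?thesis .
qed

text \<open>Every inverted pair contains a misjudged element \<open>y\<close>, and its other element is overtaken by \<open>y\<close>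
  unless it is misjudged as well. Conversely a misjudged \<open>y\<close> forms an inversion with each element
  that it overtakes, unless that element is misjudged too. So the two counts differ at most by the
  number of pairs of distinct misjudged elements.\<close>
lemma cross_inversions_approx:
  assumes "finite A" "x \<in> A"
  defines "e \<equiv> \<lambda>f. real (card {y \<in> A - {x}. f y})"
  shows "\<bar>real (cross_inversions (insert x (declared_small A x f)) (insert x (declared_large A x f)))
     - (\<Sum>y\<in>A - {x}. real (card (overtaken A x y)) * of_bool (f y))\<bar> \<le> e f * (e f - 1)"
proof -
  let ?L = "insert x (declared_small A x f)" and ?R = "insert x (declared_large A x f)"
  define E where "E = {y \<in> A - {x}. f y}"
  define P where "P = {(a, b). a \<in> ?L \<and> b \<in> ?R \<and> b < a}"
  define Q where "Q = {(a, b). a \<in> A \<and> b \<in> A \<and> b < a \<and> (a \<le> x \<and> b \<in> E \<or> x \<le> b \<and> a \<in> E)}"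
  define D where "D = (SIGMA a:E. E - {a})"
  have finE: "finite E" using assms(1) by (simp add: E_def)
  have "P \<subseteq> A \<times> A" "Q \<subseteq> A \<times> A" "D \<subseteq> E \<times> E"
    using assms(2) by (auto simp: P_def Q_def D_def declared_small_def declared_large_def)
  hence fin: "finite P" "finite Q" "finite D"
    using assms(1) finE by (auto intro: finite_subset)
  have "P \<subseteq> Q \<union> D" "Q \<subseteq> P \<union> D"
    using assms(2) by (auto simp: P_def Q_def D_def E_def declared_small_def declared_large_def)
  hence "card P \<le> card (Q \<union> D)" "card Q \<le> card (P \<union> D)"
    using fin by (auto intro!: card_mono)
  hence "\<bar>real (card P) - real (card Q)\<bar> \<le> card D"
    using card_Un_le[of Q D] card_Un_le[of P D] by linarith
  moreover have "real (card D) = e f * (e f - 1)"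
  proof -
    have "real (card D) = (\<Sum>a\<in>E. real (card (E - {a})))"
      unfolding D_def using finE by (subst card_SigmaI) auto
    also have "\<dots> = (\<Sum>a\<in>E. real (card E) - 1)"
    proof (intro sum.cong refl)
      fix a assume "a \<in> E"
      with finE have "card E \<ge> 1" by (simp add: Suc_le_eq card_gt_0_iff) blast
      with \<open>a \<in> E\<close> finE show "real (card (E - {a})) = real (card E) - 1" by (simp add: of_nat_diff)
    qed
    finally show ?thesis by (simp add: e_def E_def)
  qed
  moreover have "real (card Q) = (\<Sum>y\<in>A - {x}. real (card (overtaken A x y)) * of_bool (f y))"
  proof -
    let ?h = "\<lambda>(y, z). if y < x then (z, y) else (y, z)"
    have "Q = ?h ` (SIGMA y:E. overtaken A x y)"
    proof (intro equalityI subsetI)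
      fix ab assume "ab \<in> Q"
      then obtain a b where ab: "ab = (a, b)" "a \<in> A" "b \<in> A" "b < a" "a \<le> x \<and> b \<in> E \<or> x \<le> b \<and> a \<in> E"
        by (auto simp: Q_def)
      from ab(5) show "ab \<in> ?h ` (SIGMA y:E. overtaken A x y)"
      proof
        assume *: "a \<le> x \<and> b \<in> E"
        show ?thesis by (rule image_eqI[of _ _ "(b, a)"]) (use * ab in \<open>auto simp: overtaken_def\<close>)
      next
        assume *: "x \<le> b \<and> a \<in> E"
        show ?thesis by (rule image_eqI[of _ _ "(a, b)"]) (use * ab in \<open>auto simp: overtaken_def\<close>)
      qed
    qed (use assms(2) in \<open>auto simp: Q_def E_def overtaken_def split: if_splits\<close>)
    moreover have "inj_on ?h (SIGMA y:E. overtaken A x y)"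
      by (rule inj_onI) (auto simp: overtaken_def E_def split: if_splits)
    ultimately have "card Q = card (SIGMA y:E. overtaken A x y)" by (simp add: card_image)
    also have "\<dots> = (\<Sum>y\<in>E. card (overtaken A x y))"
      using finE assms(1) by (intro card_SigmaI) (auto simp: overtaken_def)
    finally have "real (card Q) = (\<Sum>y\<in>E. real (card (overtaken A x y)))" by simp
    also have "\<dots> = (\<Sum>y\<in>A - {x}. real (card (overtaken A x y)) * of_bool (f y))"
      using assms(1) unfolding E_def by (intro sum.mono_neutral_cong_left) auto
    finally show ?thesis .
  qed
  ultimately show ?thesis by (simp add: P_def cross_inversions_def)
qed


section \<open>One step of the recursion compared with the limit equation\<close>

text \<open>On each of the \<open>n\<close> subintervals the integrand deviates by at most \<open>K / n\<close> from its value at the left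
  end.\<close>
lemma riemann_sum_lipschitz:
  fixes h :: "real \<Rightarrow> complex" and n :: nat
  assumes "continuous_on UNIV h" "n > 0" "0 \<le> K"
    and lip: "\<And>u v. u \<in> {0..1} \<Longrightarrow> v \<in> {0..1} \<Longrightarrow> cmod (h u - h v) \<le> K * \<bar>u - v\<bar>"
  shows "cmod ((\<Sum>s<n. h (real s / n)) / n - integral\<^sup>L unif h) \<le> K / n"
proof -
  have int: "h integrable_on {a..b}" for a b
    by (rule integrable_continuous_interval) (use assms(1) continuous_on_subset in blast)
  have "cmod ((\<Sum>s<m. h (real s / n)) / n - integral {0..m / n} h) \<le> m * (K / n / n)" if "m \<le> n" for m :: nat
    using that
  proof (induction m)
    case (Suc m)
    define a b where "a = real m / n" and "b = real (Suc m) / n"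
    have ab: "0 \<le> a" "b \<le> 1" "b - a = 1 / n"
      using assms(2) Suc.prems by (simp_all add: a_def b_def field_simps)
    hence "a \<le> b" using assms(2) by (simp add: algebra_simps)
    have "integral {0..a} h + integral {a..b} h = integral {0..b} h"
      using ab \<open>a \<le> b\<close> by (intro Henstock_Kurzweil_Integration.integral_combine int) auto
    moreover have "cmod (h a / n - integral {a..b} h) \<le> K / n / n"
    proof -
      have "((\<lambda>u. h a - h u) has_integral (b - a) *\<^sub>R h a - integral {a..b} h) {a..b}"
        using has_integral_const_real[of "h a" a b] \<open>a \<le> b\<close>
        by (intro has_integral_diff integrable_integral int) simp
      hence "cmod ((b - a) *\<^sub>R h a - integral {a..b} h) \<le> K / n * measure lborel {a..b}"
      proof (rule has_integral_bound_real[rotated 2])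
        show "cmod (h a - h u) \<le> K / n" if u: "u \<in> {a..b} - {}" for u
        proof -
          have "cmod (h a - h u) \<le> K * \<bar>a - u\<bar>" using u ab by (intro lip) auto
          also have "\<dots> \<le> K * (1 / n)" using u ab assms(3) by (intro mult_left_mono) auto
          finally show ?thesis by simp
        qed
      qed (use assms in auto)
      thus ?thesis using ab \<open>a \<le> b\<close> by (simp add: scaleR_conv_of_real divide_inverse mult_ac)
    qed
    ultimately have "cmod ((\<Sum>s<Suc m. h (real s / n)) / n - integral {0..b} h)
       \<le> m * (K / n / n) + K / n / n"
      using Suc norm_triangle_ineq[of "(\<Sum>s<m. h (real s / n)) / n - integral {0..a} h" "h a / n - integral {a..b} h"]
      by (simp add: add_divide_distrib algebra_simps a_def[symmetric])
    thus ?case unfolding b_def by (simp add: algebra_simps add_divide_distrib)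
  qed simp
  from this[of n] show ?thesis using assms(2) by (simp add: unif_integral(2)[OF assms(1)])
qed

lemma (in real_distribution) split_integrand_lipschitz:
  assumes "integrable M (\<lambda>x. x)" "u \<in> {0..1}" "v \<in> {0..1}"
  shows "cmod (split_integrand (char M) t u - split_integrand (char M) t v) \<le>
    \<bar>t\<bar> * (4 * integral\<^sup>L M (\<lambda>x. \<bar>x\<bar>) + 1) * \<bar>u - v\<bar>"
proof -
  let ?m = "integral\<^sup>L M (\<lambda>x. \<bar>x\<bar>)"
  have m: "?m \<ge> 0" by simp
  have sq: "\<bar>a\<^sup>2 * t - b\<^sup>2 * t\<bar> \<le> \<bar>t\<bar> * 2 * \<bar>a - b\<bar>" if "a \<in> {0..1}" "b \<in> {0..1}" for a b
  proof -
    have "a\<^sup>2 * t - b\<^sup>2 * t = t * (a + b) * (a - b)" by (simp add: power2_eq_square algebra_simps)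
    hence "\<bar>a\<^sup>2 * t - b\<^sup>2 * t\<bar> = \<bar>t\<bar> * \<bar>a + b\<bar> * \<bar>a - b\<bar>" by (simp add: abs_mult)
    also have "\<dots> \<le> \<bar>t\<bar> * 2 * \<bar>a - b\<bar>" using that by (intro mult_right_mono mult_left_mono) auto
    finally show ?thesis .
  qed
  have c: "cmod (char M (a\<^sup>2 * t) - char M (b\<^sup>2 * t)) \<le> \<bar>t\<bar> * 2 * \<bar>a - b\<bar> * ?m" if "a \<in> {0..1}" "b \<in> {0..1}" for a b
    by (rule order_trans[OF char_lipschitz[OF assms(1)]]) (intro mult_right_mono sq that m)
  have "toll u - toll v = (u + v - 1) * (u - v)"
    by (simp add: toll_def power2_eq_square field_simps)
  hence "\<bar>t * toll u - t * toll v\<bar> = \<bar>t\<bar> * (\<bar>u + v - 1\<bar> * \<bar>u - v\<bar>)"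
    by (simp add: abs_mult flip: right_diff_distrib)
  also have "\<dots> \<le> \<bar>t\<bar> * (1 * \<bar>u - v\<bar>)" using assms by (intro mult_left_mono mult_right_mono) auto
  finally have T: "cmod (iexp (t * toll u) - iexp (t * toll v)) \<le> \<bar>t\<bar> * \<bar>u - v\<bar>"
    using iexp_lipschitz[of "t * toll u" "t * toll v"] by simp
  have "cmod (split_integrand (char M) t u - split_integrand (char M) t v) \<le>
    cmod (char M (u\<^sup>2 * t) - char M (v\<^sup>2 * t)) + cmod (char M ((1 - u)\<^sup>2 * t) - char M ((1 - v)\<^sup>2 * t)) + 
    cmod (iexp (t * toll u) - iexp (t * toll v))"
    unfolding split_integrand_def by (rule norm_triple_product_diff) (auto intro: cmod_char_le_1)
  also have "\<dots> \<le> \<bar>t\<bar> * 2 * \<bar>u - v\<bar> * ?m + \<bar>t\<bar> * 2 * \<bar>(1 - u) - (1 - v)\<bar> * ?m + \<bar>t\<bar> * \<bar>u - v\<bar>"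
    using assms by (intro add_mono c T) auto
  also have "\<bar>(1 - u) - (1 - v)\<bar> = \<bar>u - v\<bar>" by simp
  finally show ?thesis by (simp add: algebra_simps)
qed

text \<open>Divided by \<open>m\<^sup>2\<close> this is \<open>1 / sqrt (m p) + p\<close>, the speed of convergence for inputs of length \<open>m\<close>.\<close>
definition rate :: "real \<Rightarrow> nat \<Rightarrow> real" where
  "rate p m = m * sqrt m / sqrt p + p * (real m)\<^sup>2"

text \<open>The power \<open>3/2\<close> of the length is bounded by its square and a constant, so that only second moments
  of the lengths of the sublists are needed: with \<open>v = sqrt (m / n)\<close> this says
  \<open>v\<^sup>3 \<le> v\<^sup>4 + 27/256\<close>, where equality holds at \<open>v = 3/4\<close>.\<close>
lemma rate_le:
  assumes "n > 0" "p > 0"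
  shows "rate p m \<le> (real m)\<^sup>2 * (rate p n / (real n)\<^sup>2) + 27/256 * (n * sqrt n / sqrt p)"
proof -
  define a b where "a = sqrt m" and "b = sqrt n"
  have b: "b > 0" "real n = b\<^sup>2" and a: "a \<ge> 0" "real m = a\<^sup>2" using assms by (auto simp: a_def b_def)
  have "a^4 - a^3 * b + 27/256 * b^4 = (a - 3/4 * b)\<^sup>2 * (a\<^sup>2 + a * b / 2 + 3/16 * b\<^sup>2)"
    by (simp add: power2_eq_square power3_eq_cube power4_eq_xxxx algebra_simps)
  also have "\<dots> \<ge> 0" using a b by (intro mult_nonneg_nonneg add_nonneg_nonneg) auto
  finally have "a^3 \<le> a^4 / b + 27/256 * b^3"
    using b(1) by (simp add: field_simps power3_eq_cube power4_eq_xxxx)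
  hence "a^3 / sqrt p \<le> (a^4 / b + 27/256 * b^3) / sqrt p" using assms by (intro divide_right_mono) auto
  moreover have "(real m)\<^sup>2 * (rate p n / (real n)\<^sup>2) = a^4 / b / sqrt p + p * a^4"
    using b(1) assms(2) by (simp add: rate_def b(2) a(2)) (simp add: field_simps power2_eq_square power4_eq_xxxx)
  moreover have "rate p m = a^3 / sqrt p + p * a^4"
    using a(1) by (simp add: rate_def a(2)) (simp add: power2_eq_square power3_eq_cube power4_eq_xxxx)
  moreover have "n * sqrt n = b^3"
    using b(1) by (simp add: b(2)) (simp add: power2_eq_square power3_eq_cube)
  ultimately show ?thesis by (simp add: add_divide_distrib)
qed

lemma abs_diff_squares_le:
  fixes l s e n :: real
  assumes "\<bar>l - s\<bar> \<le> e" "0 \<le> l" "l \<le> n" "0 \<le> s" "s \<le> n"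
  shows "\<bar>l\<^sup>2 - s\<^sup>2\<bar> \<le> 2 * n * e"
proof -
  have "l\<^sup>2 - s\<^sup>2 = (l - s) * (l + s)" by (simp add: power2_eq_square algebra_simps)
  hence "\<bar>l\<^sup>2 - s\<^sup>2\<bar> = \<bar>l - s\<bar> * (l + s)" using assms by (simp add: abs_mult)
  also have "\<dots> \<le> e * (2 * n)" using assms by (intro mult_mono) auto
  finally show ?thesis by (simp add: mult_ac)
qed

lemma cmod_inv_char_le_1: "cmod (inv_char A p \<theta>) \<le> 1"
  unfolding inv_char_def
  by (rule order_trans[OF integral_norm_bound measure_pmf.integral_le_const])
     (auto intro!: measure_pmf.integrable_const_bound[where B = 1])

text \<open>One step for a fixed pivot \<open>x\<close> and error pattern \<open>f\<close>, compared with the integrand of the limit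
  equation at \<open>u = s/n\<close>. The induction hypothesis replaces the transforms of the sublists by \<open>char \<mu>\<close>,
  the Lipschitz property of \<open>char \<mu>\<close> then replaces the actual lengths by \<open>s\<close> and \<open>n - s\<close>, and the
  cross inversions are replaced by their approximate mean. The bound is written as a function of the
  number \<open>e\<close> of errors and the centred weighted sum \<open>Z\<close>, the two random quantities left to average.\<close>
lemma split_step_pointwise:
  fixes A :: "'a::linorder set" and f :: "'a \<Rightarrow> bool"
  assumes \<mu>: "real_distribution \<mu>" "integrable \<mu> (\<lambda>x. x)"
    and p: "0 < p" and "0 \<le> c" and A: "finite A" "x \<in> A"
    and IH: "\<And>B :: 'a set. finite B \<Longrightarrow> card B < card A \<Longrightarrow>
       cmod (inv_char B p \<theta> - char \<mu> ((real (card B))\<^sup>2 * p * \<theta>)) \<le> \<bar>\<theta>\<bar> * (p * (c * rate p (card B)))"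
  defines "M \<equiv> integral\<^sup>L \<mu> (\<lambda>x. \<bar>x\<bar>)" and "n \<equiv> real (card A)"
    and "s \<equiv> real (card {y \<in> A. y < x})" and "g \<equiv> real (card {y \<in> A. x < y})"
    and "e \<equiv> real (card {y \<in> A - {x}. f y})"
    and "Z \<equiv> \<Sum>y\<in>A - {x}. real (card (overtaken A x y)) * (of_bool (f y) - p)"
    and "r \<equiv> rate p (card A) / (real (card A))\<^sup>2" and "W \<equiv> card A * sqrt (card A) / sqrt p"
  shows "cmod (inv_char (declared_small A x f) p \<theta> * inv_char (declared_large A x f) p \<theta> *
       iexp (\<theta> * real (cross_inversions (insert x (declared_small A x f)) (insert x (declared_large A x f))))
       - split_integrand (char \<mu>) (n\<^sup>2 * p * \<theta>) (s / n))
     \<le> \<bar>\<theta>\<bar> * ((p * c * (r * (s\<^sup>2 + g\<^sup>2) + 27/128 * W) + 2 * p * M * n + p * n / 2)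
            + (4 * p * c * r * n + 4 * p * M * n) * e + e * (e - 1) + \<bar>Z\<bar>)"
proof -
  interpret real_distribution \<mu> by fact
  let ?L = "declared_small A x f" and ?R = "declared_large A x f"
  define l where "l = real (card ?L)"
  define q where "q = real (card ?R)"
  define C where "C = real (cross_inversions (insert x ?L) (insert x ?R))"
  have M: "M \<ge> 0" by (simp add: M_def)
  have fin: "finite ?L" "finite ?R" using A by (auto simp: declared_small_def declared_large_def)
  have "?L \<subset> A" "?R \<subset> A" using A by (auto simp: declared_small_def declared_large_def)
  hence lt: "card ?L < card A" "card ?R < card A" using A by (auto intro: psubset_card_mono)
  have "A = insert x ({y \<in> A. y < x} \<union> {y \<in> A. x < y})" using A by auto
  hence "card A = card (insert x ({y \<in> A. y < x} \<union> {y \<in> A. x < y}))" by simp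
  also have "\<dots> = Suc (card ({y \<in> A. y < x} \<union> {y \<in> A. x < y}))" using A by (subst card_insert_disjoint) auto
  also have "card ({y \<in> A. y < x} \<union> {y \<in> A. x < y}) = card {y \<in> A. y < x} + card {y \<in> A. x < y}"
    using A by (intro card_Un_disjoint) auto
  finally have n: "n = s + g + 1" by (simp add: n_def s_def g_def)
  have nonneg: "s \<ge> 0" "g \<ge> 0" "e \<ge> 0" "l \<ge> 0" "q \<ge> 0" by (simp_all add: s_def g_def e_def l_def q_def)
  have r: "r \<ge> 0" using p by (simp add: r_def rate_def)
  have le: "l \<le> n" "q \<le> n" using lt by (simp_all add: l_def q_def n_def)
  have ls: "\<bar>l - s\<bar> \<le> e" unfolding l_def s_def e_def by (rule card_declared_small_diff[OF A(1)])
  have qg: "\<bar>q - g\<bar> \<le> e" unfolding q_def g_def e_def by (rule card_declared_large_diff[OF A(1)])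
  have sq1: "\<bar>l\<^sup>2 - s\<^sup>2\<bar> \<le> 2 * n * e"
    by (rule abs_diff_squares_le) (use ls nonneg le n in auto)
  \<comment> \<open>The limit equation has \<open>n - s = g + 1\<close> where the sublist has about \<open>g\<close> elements.\<close>
  have sq2: "\<bar>q\<^sup>2 - (g + 1)\<^sup>2\<bar> \<le> 2 * n * (e + 1)"
    by (rule abs_diff_squares_le) (use qg nonneg le n in auto)
  have sq3: "\<bar>q\<^sup>2 - g\<^sup>2\<bar> \<le> 2 * n * e"
    by (rule abs_diff_squares_le) (use qg nonneg le n in auto)
  have part: "cmod (inv_char B p \<theta> - char \<mu> (a * p * \<theta>)) \<le> \<bar>\<theta>\<bar> * (p * (c * rate p (card B)) + p * M * d)"
    if B: "finite B" "card B < card A" and d: "\<bar>(real (card B))\<^sup>2 - a\<bar> \<le> d" for B :: "'a set" and a d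
  proof -
    have "cmod (inv_char B p \<theta> - char \<mu> (a * p * \<theta>)) \<le> cmod (inv_char B p \<theta> - char \<mu> ((real (card B))\<^sup>2 * p * \<theta>))
       + cmod (char \<mu> ((real (card B))\<^sup>2 * p * \<theta>) - char \<mu> (a * p * \<theta>))"
      using norm_triangle_ineq[of "inv_char B p \<theta> - char \<mu> ((real (card B))\<^sup>2 * p * \<theta>)"
          "char \<mu> ((real (card B))\<^sup>2 * p * \<theta>) - char \<mu> (a * p * \<theta>)"] by simp
    also have "cmod (char \<mu> ((real (card B))\<^sup>2 * p * \<theta>) - char \<mu> (a * p * \<theta>)) \<le>
        \<bar>(real (card B))\<^sup>2 * p * \<theta> - a * p * \<theta>\<bar> * M"
      unfolding M_def by (rule char_lipschitz[OF \<mu>(2)])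
    also have "\<bar>(real (card B))\<^sup>2 * p * \<theta> - a * p * \<theta>\<bar> = \<bar>(real (card B))\<^sup>2 - a\<bar> * p * \<bar>\<theta>\<bar>"
      using p by (simp add: abs_mult flip: left_diff_distrib)
    also have "\<dots> * M \<le> d * p * \<bar>\<theta>\<bar> * M" using p M d by (intro mult_right_mono) auto
    finally show ?thesis using IH[OF B] by (simp add: algebra_simps)
  qed
  have n0: "n > 0" using n nonneg by simp
  have s_n: "(s / n)\<^sup>2 * (n\<^sup>2 * p * \<theta>) = s\<^sup>2 * p * \<theta>" "(1 - s / n)\<^sup>2 * (n\<^sup>2 * p * \<theta>) = (g + 1)\<^sup>2 * p * \<theta>"
  proof -
    have "1 - s / n = (g + 1) / n" using n n0 by (simp add: field_simps)
    thus "(s / n)\<^sup>2 * (n\<^sup>2 * p * \<theta>) = s\<^sup>2 * p * \<theta>" "(1 - s / n)\<^sup>2 * (n\<^sup>2 * p * \<theta>) = (g + 1)\<^sup>2 * p * \<theta>"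
      using n0 by (simp_all add: power_divide)
  qed
  have "n\<^sup>2 * p * \<theta> * toll (s / n) = 
      ((s / n)\<^sup>2 * (n\<^sup>2 * p * \<theta>) + (1 - s / n)\<^sup>2 * (n\<^sup>2 * p * \<theta>)) / 2"
    by (simp only: toll_def) (simp add: algebra_simps)
  hence toll: "n\<^sup>2 * p * \<theta> * toll (s / n) = \<theta> * (p * (s\<^sup>2 + (g + 1)\<^sup>2) / 2)"
    unfolding s_n by (simp add: algebra_simps)
  define w where "w = (\<Sum>y\<in>A - {x}. real (card (overtaken A x y)))"
  have w: "w = s * (s + 1) / 2 + g * (g + 1) / 2"
    unfolding w_def s_def g_def by (rule sum_overtaken[OF A])
  have "\<bar>C - (\<Sum>y\<in>A - {x}. real (card (overtaken A x y)) * of_bool (f y))\<bar> \<le> e * (e - 1)"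
    unfolding C_def e_def by (rule cross_inversions_approx[OF A])
  moreover have "(\<Sum>y\<in>A - {x}. real (card (overtaken A x y)) * of_bool (f y)) = Z + p * w"
    by (simp add: Z_def w_def sum_distrib_left sum.distrib[symmetric] algebra_simps)
  moreover have "p * w - p * (s\<^sup>2 + (g + 1)\<^sup>2) / 2 = p * (s - g - 1) / 2"
    unfolding w by (simp add: power2_eq_square field_simps)
  moreover have "\<bar>p * (s - g - 1) / 2\<bar> \<le> p * n / 2"
    using p nonneg by (simp add: abs_mult n)
  ultimately have C: "\<bar>C - p * (s\<^sup>2 + (g + 1)\<^sup>2) / 2\<bar> \<le> e * (e - 1) + \<bar>Z\<bar> + p * n / 2" by linarith
  have "cmod (iexp (\<theta> * C) - iexp (n\<^sup>2 * p * \<theta> * toll (s / n))) \<le> \<bar>\<theta> * C - n\<^sup>2 * p * \<theta> * toll (s / n)\<bar>"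
    by (rule iexp_lipschitz)
  also have "\<dots> = \<bar>\<theta>\<bar> * \<bar>C - p * (s\<^sup>2 + (g + 1)\<^sup>2) / 2\<bar>"
    unfolding toll by (simp only: abs_mult[symmetric] right_diff_distrib)
  also have "\<dots> \<le> \<bar>\<theta>\<bar> * (e * (e - 1) + \<bar>Z\<bar> + p * n / 2)" using C by (intro mult_left_mono) auto
  finally have T: "cmod (iexp (\<theta> * C) - iexp (n\<^sup>2 * p * \<theta> * toll (s / n))) \<le> \<bar>\<theta>\<bar> * (e * (e - 1) + \<bar>Z\<bar> + p * n / 2)" .
  have n': "card A > 0" using n0 by (simp add: n_def)
  have rate1: "rate p (card ?L) \<le> (s\<^sup>2 + 2 * n * e) * r + 27/256 * W"
  proof -
    have "rate p (card ?L) \<le> l\<^sup>2 * r + 27/256 * W"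
      using rate_le[OF n' p, of "card ?L"] by (simp add: l_def r_def W_def)
    also have "l\<^sup>2 * r \<le> (s\<^sup>2 + 2 * n * e) * r" using sq1 r by (intro mult_right_mono) auto
    finally show ?thesis by simp
  qed
  have rate2: "rate p (card ?R) \<le> (g\<^sup>2 + 2 * n * e) * r + 27/256 * W"
  proof -
    have "rate p (card ?R) \<le> q\<^sup>2 * r + 27/256 * W"
      using rate_le[OF n' p, of "card ?R"] by (simp add: q_def r_def W_def)
    also have "q\<^sup>2 * r \<le> (g\<^sup>2 + 2 * n * e) * r" using sq3 r by (intro mult_right_mono) auto
    finally show ?thesis by simp
  qed
  have "p * c * (rate p (card ?L) + rate p (card ?R)) \<le> 
     p * c * (((s\<^sup>2 + 2 * n * e) * r + 27/256 * W) + ((g\<^sup>2 + 2 * n * e) * r + 27/256 * W))"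
    using p \<open>0 \<le> c\<close> by (intro mult_left_mono add_mono rate1 rate2) auto
  hence rates: "p * (c * rate p (card ?L)) + p * (c * rate p (card ?R)) \<le> 
     p * c * (r * (s\<^sup>2 + g\<^sup>2) + 27/128 * W) + 4 * p * c * r * n * e"
    by (simp add: algebra_simps)
  have "cmod (inv_char ?L p \<theta> * inv_char ?R p \<theta> * iexp (\<theta> * C) - split_integrand (char \<mu>) (n\<^sup>2 * p * \<theta>) (s / n))
    \<le> cmod (inv_char ?L p \<theta> - char \<mu> (s\<^sup>2 * p * \<theta>)) + cmod (inv_char ?R p \<theta> - char \<mu> ((g + 1)\<^sup>2 * p * \<theta>))
     + cmod (iexp (\<theta> * C) - iexp (n\<^sup>2 * p * \<theta> * toll (s / n)))"
    unfolding split_integrand_def s_n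
    by (rule norm_triple_product_diff) (auto intro: cmod_inv_char_le_1 cmod_char_le_1)
  also have "\<dots> \<le> \<bar>\<theta>\<bar> * (p * (c * rate p (card ?L)) + p * M * (2 * n * e)) + 
     \<bar>\<theta>\<bar> * (p * (c * rate p (card ?R)) + p * M * (2 * n * (e + 1))) + \<bar>\<theta>\<bar> * (e * (e - 1) + \<bar>Z\<bar> + p * n / 2)"
    by (intro add_mono part T fin lt sq1[unfolded l_def] sq2[unfolded q_def])
  also have "\<dots> = \<bar>\<theta>\<bar> * (p * (c * rate p (card ?L)) + p * (c * rate p (card ?R)) + 4 * p * M * n * e + 2 * p * M * n
      + e * (e - 1) + \<bar>Z\<bar> + p * n / 2)"
    by (simp add: algebra_simps)
  also have "\<dots> \<le> \<bar>\<theta>\<bar> * (p * c * (r * (s\<^sup>2 + g\<^sup>2) + 27/128 * W) + 4 * p * c * r * n * e + 4 * p * M * n * e + 2 * p * M * n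
      + e * (e - 1) + \<bar>Z\<bar> + p * n / 2)"
    using rates by (intro mult_left_mono) auto
  also have "\<dots> = \<bar>\<theta>\<bar> * ((p * c * (r * (s\<^sup>2 + g\<^sup>2) + 27/128 * W) + 2 * p * M * n + p * n / 2)
            + (4 * p * c * r * n + 4 * p * M * n) * e + e * (e - 1) + \<bar>Z\<bar>)"
    by (simp add: algebra_simps)
  finally show ?thesis unfolding C_def .
qed

text \<open>Averaging over the error pattern uses only the mean of \<open>e\<close>, the mean of \<open>e (e - 1)\<close>, and the
  standard deviation of the weighted sum, whose weights are at most \<open>n\<close>.\<close>
lemma split_step_mean:
  fixes A :: "'a::linorder set"
  assumes A: "finite A" "x \<in> A" and p: "0 < p" "p \<le> 1" and ab: "0 \<le> b"
    and bound: "\<And>f. cmod (F f - z) \<le> t * (a + b * real (card {y \<in> A - {x}. f y}) 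
       + real (card {y \<in> A - {x}. f y}) * (real (card {y \<in> A - {x}. f y}) - 1) 
       + \<bar>\<Sum>y\<in>A - {x}. real (card (overtaken A x y)) * (of_bool (f y) - p)\<bar>)"
    and t: "0 \<le> t"
  defines "n \<equiv> real (card A)"
  shows "cmod (measure_pmf.expectation (coin_flips (A - {x}) p) F - z) \<le> 
     t * (a + b * (p * n) + (p * n)\<^sup>2 + p * (n * sqrt n / sqrt p))"
proof -
  let ?P = "coin_flips (A - {x}) p"
  define e where "e = (\<lambda>f. real (card {y \<in> A - {x}. f y}))"
  define Z where "Z = (\<lambda>f. \<bar>\<Sum>y\<in>A - {x}. real (card (overtaken A x y)) * (of_bool (f y) - p)\<bar>)"
  have fin: "finite (A - {x})" using A by simp
  have ic: "integrable ?P g" for g :: "_ \<Rightarrow> complex" by (rule integrable_coin_flips[OF fin])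
  have ir: "integrable ?P g" for g :: "_ \<Rightarrow> real" by (rule integrable_coin_flips[OF fin])
  have m: "real (card (A - {x})) \<le> n" using A by (simp add: n_def card_mono)
  have E1: "measure_pmf.expectation ?P e \<le> p * n"
    using expectation_errors(1)[OF fin, of p] p m by (simp add: e_def)
  have "measure_pmf.expectation ?P (\<lambda>f. e f * (e f - 1)) \<le> (p * real (card (A - {x})))\<^sup>2"
    unfolding e_def using p by (intro expectation_errors(2) fin) auto
  also have "\<dots> \<le> (p * n)\<^sup>2" using p m by (intro power_mono mult_left_mono) auto
  finally have E2: "measure_pmf.expectation ?P (\<lambda>f. e f * (e f - 1)) \<le> (p * n)\<^sup>2" .
  have "measure_pmf.expectation ?P Z \<le> sqrt (p * (\<Sum>y\<in>A - {x}. (real (card (overtaken A x y)))\<^sup>2))"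
    unfolding Z_def using p by (intro abs_deviation_coin_flips fin) auto
  also have "\<dots> \<le> sqrt (p * (\<Sum>y\<in>A - {x}. n\<^sup>2))"
    using p A unfolding n_def
    by (intro real_sqrt_le_mono mult_left_mono sum_mono power_mono of_nat_mono card_overtaken_le) auto
  also have "\<dots> \<le> sqrt (p * (n * n\<^sup>2))"
    using p m by (intro real_sqrt_le_mono mult_left_mono) (auto intro: mult_right_mono)
  also have "\<dots> = p * (n * sqrt n / sqrt p)"
  proof -
    have "sqrt (p * (n * n\<^sup>2)) = sqrt p * (sqrt n * n)" by (simp add: real_sqrt_mult n_def)
    also have "sqrt p = p / sqrt p" using p by (simp add: real_div_sqrt)
    finally show ?thesis by (simp add: mult_ac)
  qed
  finally have E3: "measure_pmf.expectation ?P Z \<le> p * (n * sqrt n / sqrt p)" .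
  have "measure_pmf.expectation ?P F - z = measure_pmf.expectation ?P (\<lambda>f. F f - z)"
    using ic by simp
  also have "cmod \<dots> \<le> measure_pmf.expectation ?P (\<lambda>f. t * (a + b * e f + e f * (e f - 1) + Z f))"
    unfolding e_def Z_def by (rule order_trans[OF integral_norm_bound Bochner_Integration.integral_mono[OF ir ir bound]])
  also have "\<dots> = t * (a + b * measure_pmf.expectation ?P e + measure_pmf.expectation ?P (\<lambda>f. e f * (e f - 1)) 
       + measure_pmf.expectation ?P Z)"
    using ir by (simp del: right_diff_distrib)
  also have "\<dots> \<le> t * (a + b * (p * n) + (p * n)\<^sup>2 + p * (n * sqrt n / sqrt p))"
    using t ab by (intro mult_left_mono add_mono E1 E2 E3 order_refl) auto
  finally show ?thesis .
qed

section \<open>Convergence in distribution\<close>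

lemma sum_squares_le: "(\<Sum>k<n. (real k)\<^sup>2) \<le> real n ^ 3 / 3"
proof (induction n)
  case (Suc n)
  have "real n ^ 3 / 3 + (real n)\<^sup>2 \<le> real (Suc n) ^ 3 / 3"
    by (simp add: power3_eq_cube power2_eq_square algebra_simps add_divide_distrib)
  with Suc show ?case by simp
qed simp

text \<open>Strong induction on the size. Write \<open>W\<close> and \<open>V\<close> for the two summands of \<open>rate p n\<close>. The induction
  hypothesis reproduces the bound with \<open>W + V\<close> multiplied by \<open>2/3 + 27/128\<close>, plus \<open>4p\<close> for the
  changes of length due to errors; for \<open>p \<le> 1/100\<close> the total stays below \<open>23/25\<close>. All other
  contributions, including the Riemann sum error, are (after division by \<open>|\<theta>| p\<close>) at most \<open>(6M + 5/2)(W + V)\<close> with \<open>M\<close> the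
  first absolute moment of \<open>\<mu>\<close>, and \<open>c = 125 (M + 1)\<close> makes the remaining \<open>2/25\<close> of \<open>c\<close> absorb them.\<close>
lemma inv_char_approx:
  fixes A :: "'a::linorder set"
  assumes \<mu>: "real_distribution \<mu>" "integrable \<mu> (\<lambda>x. x)" "rhs_law \<mu> = \<mu>"
    and p: "0 < p" "p \<le> 1/100" and "finite A"
  defines "c \<equiv> 125 * (integral\<^sup>L \<mu> (\<lambda>x. \<bar>x\<bar>) + 1)"
  shows "cmod (inv_char A p \<theta> - char \<mu> ((real (card A))\<^sup>2 * p * \<theta>)) \<le> \<bar>\<theta>\<bar> * (p * (c * rate p (card A)))"
  using \<open>finite A\<close>
proof (induction "card A" arbitrary: A rule: less_induct)
  case less
  interpret real_distribution \<mu> by fact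
  define M where "M = integral\<^sup>L \<mu> (\<lambda>x. \<bar>x\<bar>)"
  have M: "M \<ge> 0" by (simp add: M_def)
  have c: "c = 125 * (M + 1)" by (simp add: c_def M_def)
  show ?case
  proof (cases "A = {}")
    case True
    have "inversions_pmf ({} :: 'a set) p = return_pmf 0"
      by (simp add: inversions_pmf_def pmf_of_set_singleton bind_return_pmf inversions_def)
    thus ?thesis using True by (simp add: inv_char_def char_zero rate_def)
  next
    case False
    define n where "n = real (card A)"
    have n: "n > 0" using False less.prems by (simp add: n_def card_gt_0_iff)
    define W where "W = n * sqrt n / sqrt p"
    define r where "r = rate p (card A) / n\<^sup>2"
    define V where "V = p * n\<^sup>2"
    have rn: "r * n\<^sup>2 = W + V" using n by (simp add: r_def rate_def W_def V_def n_def)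
    have r0: "r \<ge> 0" using p by (simp add: r_def rate_def)
    define rk where "rk = (\<lambda>x. card {y \<in> A. y < x})"
    define rk' where "rk' = (\<lambda>x. card {y \<in> A. x < y})"
    define h where "h = split_integrand (char \<mu>) (n\<^sup>2 * p * \<theta>)"
    define b where "b = 4 * p * c * r * n + 4 * p * M * n"
    define a where "a = (\<lambda>x. p * c * (r * ((real (rk x))\<^sup>2 + (real (rk' x))\<^sup>2) + 27/128 * W) + 2 * p * M * n + p * n / 2)"
    define F where "F = (\<lambda>x f. inv_char (declared_small A x f) p \<theta> * inv_char (declared_large A x f) p \<theta> *
       iexp (\<theta> * real (cross_inversions (insert x (declared_small A x f)) (insert x (declared_large A x f)))))"
    have c0: "c \<ge> 0" using M c by simp
    have "b \<ge> 0" using p M n r0 c0 by (simp add: b_def)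
    have step: "cmod (measure_pmf.expectation (coin_flips (A - {x}) p) (F x) - h (rk x / n)) 
        \<le> \<bar>\<theta>\<bar> * (a x + b * (p * n) + (p * n)\<^sup>2 + p * W)" if x: "x \<in> A" for x
      unfolding W_def n_def
    proof (rule split_step_mean)
      show "finite A" "x \<in> A" "0 < p" "p \<le> 1" "0 \<le> b" "0 \<le> \<bar>\<theta>\<bar>" by (use less.prems x p \<open>b \<ge> 0\<close> in auto)
      show "cmod (F x f - h (rk x / real (card A))) \<le> \<bar>\<theta>\<bar> * (a x + b * real (card {y \<in> A - {x}. f y}) 
       + real (card {y \<in> A - {x}. f y}) * (real (card {y \<in> A - {x}. f y}) - 1) 
       + \<bar>\<Sum>y\<in>A - {x}. real (card (overtaken A x y)) * (of_bool (f y) - p)\<bar>)" for f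
        using split_step_pointwise[where f = f, OF \<mu>(1,2) p(1) c0 less.prems x less.hyps[rotated]]
        by (simp only: F_def h_def a_def b_def rk_def rk'_def n_def M_def r_def W_def)
    qed
    have "(\<Sum>x\<in>A. (real (rk x))\<^sup>2) = (\<Sum>k<card A. (real k)\<^sup>2)"
      unfolding rk_def by (rule sum_rank[OF less.prems])
    hence s1: "(\<Sum>x\<in>A. (real (rk x))\<^sup>2) \<le> n ^ 3 / 3" using sum_squares_le[of "card A"] by (simp add: n_def)
    have "(\<Sum>x\<in>A. (real (rk' x))\<^sup>2) = (\<Sum>k<card A. (real k)\<^sup>2)"
      unfolding rk'_def by (rule sum_rank_descending[OF less.prems])
    hence s2: "(\<Sum>x\<in>A. (real (rk' x))\<^sup>2) \<le> n ^ 3 / 3" using sum_squares_le[of "card A"] by (simp add: n_def)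
    have "(\<Sum>x\<in>A. a x) = p * c * r * ((\<Sum>x\<in>A. (real (rk x))\<^sup>2) + (\<Sum>x\<in>A. (real (rk' x))\<^sup>2)) 
        + n * (p * c * (27/128 * W) + 2 * p * M * n + p * n / 2)"
      by (simp add: a_def sum.distrib sum_distrib_left[symmetric] n_def ring_distribs)
    also have "\<dots> \<le> p * c * r * (n ^ 3 / 3 + n ^ 3 / 3) + n * (p * c * (27/128 * W) + 2 * p * M * n + p * n / 2)"
      using p c0 r0 by (intro add_mono mult_left_mono s1 s2 order_refl) auto
    also have "\<dots> = n * (p * (c * (2/3 * (r * n\<^sup>2) + 27/128 * W) + 2 * M * n + n / 2))"
      by (simp add: power3_eq_cube power2_eq_square algebra_simps)
    finally have suma: "(\<Sum>x\<in>A. a x) \<le> n * (p * (c * (2/3 * (W + V) + 27/128 * W) + 2 * M * n + n / 2))"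
      unfolding rn .
    have cong_h: "(\<Sum>x\<in>A. h (rk x / n)) = (\<Sum>k<card A. h (real k / real (card A)))"
      unfolding rk_def n_def by (rule sum_rank[OF less.prems])
    have ch: "char \<mu> (n\<^sup>2 * p * \<theta>) = integral\<^sup>L unif h"
      using char_rhs_law[OF \<mu>(1)] by (simp add: \<mu>(3) h_def)
    have riem: "cmod ((\<Sum>k<card A. h (real k / real (card A))) / card A - integral\<^sup>L unif h) 
        \<le> (\<bar>n\<^sup>2 * p * \<theta>\<bar> * (4 * M + 1)) / real (card A)"
      unfolding h_def
    proof (rule riemann_sum_lipschitz)
      show "continuous_on UNIV (split_integrand (char \<mu>) (n\<^sup>2 * p * \<theta>))"
        by (rule continuous_split_integrand)
      show "0 < card A" using n by (simp add: n_def)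
    qed (use M split_integrand_lipschitz[OF \<mu>(2)] in \<open>auto simp: M_def\<close>)
    have rec: "inv_char A p \<theta> = (\<Sum>x\<in>A. measure_pmf.expectation (coin_flips (A - {x}) p) (F x)) / card A"
      using inv_char_rec[OF less.prems False] by (simp only: F_def)
    have nc: "complex_of_real n = of_nat (card A)" by (simp add: n_def)
    have "inv_char A p \<theta> - char \<mu> (n\<^sup>2 * p * \<theta>) = 
       (\<Sum>x\<in>A. measure_pmf.expectation (coin_flips (A - {x}) p) (F x) - h (rk x / n)) / n
       + ((\<Sum>k<card A. h (real k / real (card A))) / card A - integral\<^sup>L unif h)"
      by (simp add: rec ch nc sum_subtractf cong_h diff_divide_distrib)
    hence "cmod (inv_char A p \<theta> - char \<mu> (n\<^sup>2 * p * \<theta>)) \<le> 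
       cmod ((\<Sum>x\<in>A. measure_pmf.expectation (coin_flips (A - {x}) p) (F x) - h (rk x / n)) / n)
       + cmod ((\<Sum>k<card A. h (real k / real (card A))) / card A - integral\<^sup>L unif h)"
      by (simp only: norm_triangle_ineq)
    also have "cmod ((\<Sum>x\<in>A. measure_pmf.expectation (coin_flips (A - {x}) p) (F x) - h (rk x / n)) / n)
       \<le> (\<Sum>x\<in>A. \<bar>\<theta>\<bar> * (a x + b * (p * n) + (p * n)\<^sup>2 + p * W)) / n"
      unfolding norm_divide using n
      by (simp add: divide_right_mono order_trans[OF norm_sum sum_mono[OF step]])
    also have "(\<Sum>x\<in>A. \<bar>\<theta>\<bar> * (a x + b * (p * n) + (p * n)\<^sup>2 + p * W)) = 
        \<bar>\<theta>\<bar> * ((\<Sum>x\<in>A. a x) + n * (b * (p * n) + (p * n)\<^sup>2 + p * W))"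
      by (simp add: sum_distrib_left[symmetric] sum.distrib n_def algebra_simps)
    also have "\<dots> / n \<le> \<bar>\<theta>\<bar> * (n * (p * (c * (2/3 * (W + V) + 27/128 * W) + 2 * M * n + n / 2)) + n * (b * (p * n) + (p * n)\<^sup>2 + p * W)) / n"
      using n by (intro divide_right_mono mult_left_mono add_right_mono suma) auto
    also have "\<dots> = \<bar>\<theta>\<bar> * (p * (c * (2/3 * (W + V) + 27/128 * W) + 2 * M * n + n / 2 + b * n + p * n\<^sup>2 + W))"
      using n by (simp add: field_simps power2_eq_square)
    also have "b * n = 4 * p * c * (r * n\<^sup>2) + 4 * M * (p * n\<^sup>2)"
      by (simp add: b_def power2_eq_square algebra_simps)
    also note riem
    also have "(\<bar>n\<^sup>2 * p * \<theta>\<bar> * (4 * M + 1)) / real (card A) = \<bar>\<theta>\<bar> * (p * ((4 * M + 1) * n))"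
      using n p by (simp add: n_def[symmetric] abs_mult power2_eq_square)
    finally have main: "cmod (inv_char A p \<theta> - char \<mu> (n\<^sup>2 * p * \<theta>)) \<le> \<bar>\<theta>\<bar> * (p * 
       (c * (2/3 * (W + V) + 27/128 * W) + 2 * M * n + n / 2 + (4 * p * c * (W + V) + 4 * M * V) + V + W + (4 * M + 1) * n))"
      unfolding rn V_def[symmetric] by (simp add: algebra_simps)
    have "n \<ge> 1" using n by (simp add: n_def)
    have nW: "n \<le> W"
    proof -
      have "sqrt p \<le> sqrt n" using p \<open>n \<ge> 1\<close> by simp
      hence "n * sqrt p \<le> n * sqrt n" using n by (intro mult_left_mono) auto
      thus ?thesis using p by (simp add: W_def field_simps)
    qed
    have W0: "W \<ge> 0" and V0: "V \<ge> 0" using n p by (simp_all add: W_def V_def)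
    have "4 * p * c * (W + V) \<le> 4 * (1/100) * c * (W + V)"
      using p c0 W0 V0 by (intro mult_right_mono mult_left_mono) auto
    moreover have "(6 * M + 3/2) * n \<le> (6 * M + 3/2) * W"
      using nW M by (intro mult_left_mono) auto
    moreover have "c * (2/3 * (W + V) + 27/128 * W) + 2 * M * n + n / 2 + (4 * p * c * (W + V) + 4 * M * V) + V + W + (4 * M + 1) * n
       = c * (2/3 * (W + V) + 27/128 * W) + 4 * p * c * (W + V) + (6 * M + 3/2) * n + W + (4 * M + 1) * V"
      by (simp add: algebra_simps)
    ultimately have "c * (2/3 * (W + V) + 27/128 * W) + 2 * M * n + n / 2 + (4 * p * c * (W + V) + 4 * M * V) + V + W + (4 * M + 1) * n
       \<le> c * (2/3 * (W + V) + 27/128 * W) + 4 * (1/100) * c * (W + V) + (6 * M + 3/2) * W + W + (4 * M + 1) * V"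
      by linarith
    also have "\<dots> \<le> c * (W + V)"
    proof -
      have "0 \<le> M * W" "0 \<le> M * V" using M W0 V0 by auto
      thus ?thesis using W0 V0 unfolding c by (simp add: algebra_simps add_divide_distrib)
    qed
    also have "c * (W + V) = c * rate p (card A)" by (simp add: rate_def W_def V_def n_def)
    finally have "\<bar>\<theta>\<bar> * (p * 
       (c * (2/3 * (W + V) + 27/128 * W) + 2 * M * n + n / 2 + (4 * p * c * (W + V) + 4 * M * V) + V + W + (4 * M + 1) * n))
       \<le> \<bar>\<theta>\<bar> * (p * (c * rate p (card A)))"
      using p by (intro mult_left_mono) auto
    with main show ?thesis unfolding n_def by linarith
  qed
qed

lemma char_normalized_inversions_law:
  "char (normalized_inversions_law A p) t = inv_char A p (t / ((real (card A))\<^sup>2 * p))"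
  unfolding char_def normalized_inversions_law_def inv_char_def
  by (subst integral_distr) (auto simp: divide_inverse mult_ac)

text \<open>Levy's continuity theorem, with the explicit rate of \<open>inv_char_approx\<close> at \<open>\<theta> = t / (n\<^sup>2 p)\<close>.\<close>
lemma weak_conv_normalized_inversions_law:
  fixes A :: "nat \<Rightarrow> 'a::linorder set"
  assumes \<mu>: "real_distribution \<mu>" "integrable \<mu> (\<lambda>x. x)" "rhs_law \<mu> = \<mu>"
    and fin: "\<And>k. finite (A k)" and p: "\<And>k. 0 < p k" "p \<longlonglongrightarrow> 0"
    and np: "filterlim (\<lambda>k. real (card (A k)) * p k) at_top sequentially"
  shows "weak_conv_m (\<lambda>k. normalized_inversions_law (A k) (p k)) \<mu>"
proof (rule levy_continuity)
  show "real_distribution (normalized_inversions_law (A k) (p k))" for k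
    unfolding normalized_inversions_law_def by (rule prob_space.real_distribution_distr[OF prob_space_measure_pmf]) simp
  show "real_distribution \<mu>" by fact
  fix t
  define c where "c = 125 * (integral\<^sup>L \<mu> (\<lambda>x. \<bar>x\<bar>) + 1)"
  let ?n = "\<lambda>k. real (card (A k))"
  have "eventually (\<lambda>k. p k \<le> 1/100) sequentially"
    using order_tendstoD(2)[OF p(2), of "1/100"] by (auto elim: eventually_mono)
  moreover have "eventually (\<lambda>k. ?n k * p k > 0) sequentially"
    using np by (simp add: filterlim_at_top_dense)
  ultimately have bnd: "eventually (\<lambda>k. cmod (char (normalized_inversions_law (A k) (p k)) t - char \<mu> t) \<le> 
      \<bar>t\<bar> * c * (1 / sqrt (?n k * p k) + p k)) sequentially"
  proof eventually_elim
    case (elim k)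
    define \<theta> where "\<theta> = t / ((?n k)\<^sup>2 * p k)"
    have n: "?n k > 0" using elim(2) p(1)[of k] by (simp add: zero_less_mult_iff)
    have "cmod (char (normalized_inversions_law (A k) (p k)) t - char \<mu> t) = 
        cmod (inv_char (A k) (p k) \<theta> - char \<mu> ((?n k)\<^sup>2 * p k * \<theta>))"
      using n p(1)[of k] by (simp add: char_normalized_inversions_law \<theta>_def)
    also have "\<dots> \<le> \<bar>\<theta>\<bar> * (p k * (c * rate (p k) (card (A k))))"
      unfolding c_def by (rule inv_char_approx[OF \<mu> p(1) elim(1) fin])
    also have "\<dots> = \<bar>t\<bar> * c * (rate (p k) (card (A k)) / (?n k)\<^sup>2)"
      using n p(1)[of k] by (simp add: \<theta>_def abs_mult)
    also have "rate (p k) (card (A k)) / (?n k)\<^sup>2 = 1 / sqrt (?n k * p k) + p k"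
    proof -
      have "?n k * sqrt (?n k) / (?n k)\<^sup>2 = sqrt (?n k) / ?n k"
        using n by (simp add: power2_eq_square)
      also have "\<dots> = 1 / sqrt (?n k)" using n by (simp add: sqrt_divide_self_eq inverse_eq_divide)
      finally have "?n k * sqrt (?n k) / sqrt (p k) / (?n k)\<^sup>2 = 1 / sqrt (?n k) / sqrt (p k)"
        by (metis divide_divide_eq_left mult.commute)
      thus ?thesis using n by (simp add: rate_def add_divide_distrib real_sqrt_mult)
    qed
    finally show ?case .
  qed
  have lim: "(\<lambda>k. \<bar>t\<bar> * c * (1 / sqrt (?n k * p k) + p k)) \<longlonglongrightarrow> \<bar>t\<bar> * c * (0 + 0)"
  proof (intro tendsto_intros p(2))
    have "filterlim (\<lambda>k. sqrt (?n k * p k)) at_top sequentially"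
      by (rule filterlim_compose[OF sqrt_at_top np])
    thus "(\<lambda>k. 1 / sqrt (?n k * p k)) \<longlonglongrightarrow> 0"
      by (intro tendsto_divide_0[OF tendsto_const] filterlim_at_top_imp_at_infinity)
  qed
  have "(\<lambda>k. char (normalized_inversions_law (A k) (p k)) t - char \<mu> t) \<longlonglongrightarrow> 0"
    by (rule Lim_null_comparison[OF bnd]) (use lim in \<open>simp only: add_0 mult_zero_right\<close>)
  thus "(\<lambda>k. char (normalized_inversions_law (A k) (p k)) t) \<longlonglongrightarrow> char \<mu> t"
    by (rule LIM_zero_cancel)
qed

theorem theorem2p2:
  "\<exists>\<mu> :: real measure.
     finite_mean_solution \<mu> \<and>
     (\<forall>\<nu>. finite_mean_solution \<nu> \<longrightarrow> \<nu> = \<mu>) \<and>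
     (\<forall>(n :: nat \<Rightarrow> nat) (p :: nat \<Rightarrow> real) (A :: nat \<Rightarrow> real set).
        (\<forall>k. finite (A k) \<and> card (A k) = n k) \<longrightarrow>
        (\<forall>k. 0 < p k \<and> p k \<le> 1) \<longrightarrow>
        p \<longlonglongrightarrow> 0 \<longrightarrow>
        filterlim (\<lambda>k. real (n k) * p k) at_top sequentially \<longrightarrow>
        weak_conv_m (\<lambda>k. normalized_inversions_law (A k) (p k)) \<mu>) \<and>
     prob_space.expectation \<mu> (\<lambda>x. x) = 1 \<and>
     prob_space.variance \<mu> (\<lambda>x. x) = 1 / 12"
proof -
  obtain \<mu> where \<mu>: "finite_mean_solution \<mu>" and i2: "integrable \<mu> (\<lambda>x. x\<^sup>2)"
    using square_integrable_fixed_point_exists by blast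
  have rd: "real_distribution \<mu>" and i1: "integrable \<mu> (\<lambda>x. x)" and fp: "rhs_law \<mu> = \<mu>"
    using \<mu> unfolding finite_mean_solution_def by metis+
  interpret real_distribution \<mu> by fact
  note moments = finite_mean_solution_moments[OF \<mu> i2]
  have var: "variance (\<lambda>x. x) = 1 / 12"
    using variance_eq[OF i1 i2] moments by simp
  show ?thesis
  proof (intro exI conjI allI impI)
    show "finite_mean_solution \<mu>" by fact
    show "\<nu> = \<mu>" if "finite_mean_solution \<nu>" for \<nu>
      by (rule finite_mean_solution_unique[OF that \<mu>])
    show "expectation (\<lambda>x. x) = 1" by (rule moments)
    show "variance (\<lambda>x. x) = 1 / 12" by (rule var)
    show "weak_conv_m (\<lambda>k. normalized_inversions_law (A k) (p k)) \<mu>"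
      if "\<forall>k. finite (A k) \<and> card (A k) = n k" "\<forall>k. 0 < p k \<and> p k \<le> 1" "p \<longlonglongrightarrow> 0"
         "filterlim (\<lambda>k. real (n k) * p k) at_top sequentially" for n p and A :: "nat \<Rightarrow> real set"
      by (rule weak_conv_normalized_inversions_law[OF rd i1 fp]) (use that in auto)
  qed
qed

end
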